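(* Let $w\in S_\infty$. The following two conditions are equivalent: (1) any two RC-graphs of $w$ are connected by simple ladder moves; (2) $w$ avoids $1432$.
   Context: $S_\infty$ is the group of permutations of $\mathbb{Z}_{>0}$ that fix all but finitely many elements, and $s_i$ is the simple transposition exchanging $i$ and $i+1$. Products of permutations are composed as functions from right to left. RC-graphs: an RC-graph of $w\in S_\infty$ is a finite subset $D\subset\mathbb{Z}_{>0}\times\mathbb{Z}_{>0}$ such that the word obtained by reading the rows $i=1,2,3,\ldots$ in increasing order, and within each row $i$ reading the elements $(i,j)\in D$ in decreasing order of $j$, and writing $s_{i+j-1}$ for each $(i,j)\in D$, is a reduced word for $w$, i.e. $\prod_{i=1}^{\infty}\prod_{j=\infty,\,(i,j)\in D}^{1}s_{i+j-1}=w$ with $|D|$ equal to the Coxeter length of $w$. The set of RC-graphs of $w$ is denoted $\mathcal{RC}(w)$. Elements of $D$ are called crossings. Simple ladder moves: a simple ladder move (a ladder move of order $0$) on $D\in\mathcal{RC}(w)$ at a crossing $(i,j)\in D$ with $i\geq 2$ is allowed if $(i,j+1),(i-1,j),(i-1,j+1)\notin D$, and it replaces $D$ by $D'=(D\setminus\{(i,j)\})\cup\{(i-1,j+1)\}$, which again belongs to $\mathcal{RC}(w)$. Two RC-graphs of $w$ are connected by simple ladder moves if one can be transformed into the other by a finite (possibly empty) sequence of simple ladder moves and inverses of simple ladder moves. Pattern avoidance: $w$ avoids $1432$ if there are no positive integers $a_1<a_2<a_3<a_4$ with $w(a_1)<w(a_4)<w(a_3)<w(a_2)$. *)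

theory Defs
  imports Main "HOL-Combinatorics.Permutations"
begin

text \<open>Permutations of the positive integers are functions on \<^typ>\<open>nat\<close> that also fix \<open>0\<close>.\<close>

definition S_infinity :: "(nat \<Rightarrow> nat) set" where
  "S_infinity = {w. w permutes {1..} \<and> finite {i. w i \<noteq> i}}"

definition simple_transposition :: "nat \<Rightarrow> nat \<Rightarrow> nat" where
  "simple_transposition i = transpose i (i + 1)"

definition word_product :: "nat list \<Rightarrow> nat \<Rightarrow> nat" where
  "word_product as = foldr (\<circ>) (map simple_transposition as) id"

definition coxeter_length :: "(nat \<Rightarrow> nat) \<Rightarrow> nat" where
  "coxeter_length w =
    (LEAST n. \<exists>as. set as \<subseteq> {1..} \<and> length as = n \<and> word_product as = w)"

definition row_word :: "(nat \<times> nat) set \<Rightarrow> nat \<Rightarrow> nat list" where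
  "row_word D i = map (\<lambda>j. i + j - 1) (rev (sorted_list_of_set {j. (i, j) \<in> D}))"

definition reading_word :: "(nat \<times> nat) set \<Rightarrow> nat list" where
  "reading_word D = concat (map (row_word D) (sorted_list_of_set (fst ` D)))"

definition rc_graphs :: "(nat \<Rightarrow> nat) \<Rightarrow> (nat \<times> nat) set set" where
  "rc_graphs w = {D. finite D \<and> D \<subseteq> {1..} \<times> {1..} \<and>
     word_product (reading_word D) = w \<and> card D = coxeter_length w}"

text \<open>That \<open>D'\<close> is again an RC-graph of \<open>w\<close> is a consequence, so it is not imposed.\<close>

definition simple_ladder_move ::
    "(nat \<Rightarrow> nat) \<Rightarrow> (nat \<times> nat) set \<Rightarrow> (nat \<times> nat) set \<Rightarrow> bool" where
  "simple_ladder_move w D D' \<longleftrightarrow> D \<in> rc_graphs w \<and>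
     (\<exists>i j. (i, j) \<in> D \<and> i \<ge> 2 \<and>
        (i, j + 1) \<notin> D \<and> (i - 1, j) \<notin> D \<and> (i - 1, j + 1) \<notin> D \<and>
        D' = (D - {(i, j)}) \<union> {(i - 1, j + 1)})"

definition connected_by_simple_ladder_moves ::
    "(nat \<Rightarrow> nat) \<Rightarrow> (nat \<times> nat) set \<Rightarrow> (nat \<times> nat) set \<Rightarrow> bool" where
  "connected_by_simple_ladder_moves w = equivclp (simple_ladder_move w)"

definition avoids_1432 :: "(nat \<Rightarrow> nat) \<Rightarrow> bool" where
  "avoids_1432 w \<longleftrightarrow>
     \<not> (\<exists>a1 a2 a3 a4. 0 < a1 \<and> a1 < a2 \<and> a2 < a3 \<and> a3 < a4 \<and>
          w a1 < w a4 \<and> w a4 < w a3 \<and> w a3 < w a2)"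

end

theory Submission imports Defs begin

text \<open>Draw a pipe \<open>x\<close> for every position \<open>x\<close> of \<open>w\<close>. Read from right to left, the reading word of an
RC-graph moves the pipes from the bottom row up to row \<open>1\<close>, and the letter \<open>k\<close> crosses the pipes that
stand at \<open>k\<close> and \<open>k + 1\<close> at that moment. In a reduced word, two pipes that have crossed stay crossed, so the pairs
that cross are exactly the inversions of \<open>w\<close>.

\<^bold>\<open>Avoidance implies connectedness.\<close> A left-justified RC-graph of \<open>w\<close> has the Lehmer code of \<open>w\<close> as its
row lengths, so there is at most one (\<open>left_justified_rc_graph_unique\<close>). It therefore suffices to
bring every RC-graph that is not left-justified one inverse simple ladder move closer to it. Take the
leftmost column \<open>j\<close> that has an empty cell \<open>(i, j)\<close> beside a crossing \<open>(i, j + 1)\<close>, and in it the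
lowest such row \<open>i\<close>. Look at the two cells \<open>(i + 1, j)\<close> and \<open>(i + 1, j + 1)\<close> below. If both are empty,
the crossing moves down. A crossing followed by an empty cell would make the word non-reduced, and
the opposite order contradicts the choice of \<open>i\<close>. If both are crossings, then by the choice of \<open>j\<close> row \<open>i + 1\<close>
starts with \<open>j + 1\<close> crossings, so its own pipe \<open>a = i + 1\<close> crosses the pipes \<open>c\<close> and \<open>b\<close> that come from below in
columns \<open>j\<close> and \<open>j + 1\<close>, and these two cross each other at \<open>(i, j + 1)\<close>: a \<open>321\<close> pattern \<open>a < c < b\<close>. The
pipes \<open>1, \<dots>, i\<close> have not crossed \<open>b\<close> when it leaves row \<open>i\<close>; in each of the \<open>i - 1\<close> rows
above, at most one pipe can pass \<open>b\<close> from left to right (\<open>overtaking_bound\<close>). So one of these \<open>i\<close> pipes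
ends to the left of \<open>b\<close>, and together with \<open>a\<close>, \<open>c\<close>, \<open>b\<close> it forms \<open>1432\<close> (\<open>double_cross_1432\<close>).

\<^bold>\<open>Connectedness implies avoidance.\<close> A simple ladder move keeps \<open>i + j\<close> for the crossing that it moves, so the
total of \<open>i + j\<close> over an RC-graph is constant on connected components (\<open>connected_weight\<close>). Given a
\<open>1432\<close> pattern \<open>a1 < n < a3 < a4\<close> with \<open>a3 - n\<close> as small and then \<open>w a4\<close> as large as possible, two RC-graphs of different
total are written down. Factor \<open>w = u R v\<close> with \<open>R\<close> the product of the left-justified row \<open>n\<close>, and \<open>u\<close>, \<open>v\<close>
the products of the rows above and below it. By this choice the pipes \<open>a4\<close> and \<open>a3\<close> are adjacent after \<open>v\<close>, at
\<open>K\<close> and \<open>K + 1\<close>, and they are crossed there. Undo this crossing below and perform it above row \<open>n\<close> instead: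
\<open>s\<^sub>K\<close> becomes \<open>s\<^sub>k\<close> with \<open>k = K - 1\<close>, since row \<open>n\<close> crosses both pipes. Above row \<open>n\<close> the
top-justified graph is used, whose columns are the Lehmer code of \<open>u\<inverse>\<close>. The extra crossing makes the column of
the value \<open>w a4\<close> longer by one, and it still fits into the \<open>n - 1\<close> available rows because the pipe \<open>a1\<close> does not
cross \<open>a4\<close>. The crossing has moved by one diagonal, which changes the total by one
(\<open>rc_graphs_of_different_weight\<close>).\<close>

section \<open>Words in simple transpositions\<close>

lemma word_product_Nil [simp]: "word_product [] = id"
  by (simp add: word_product_def)

lemma word_product_Cons:
  "word_product (k # as) = simple_transposition k \<circ> word_product as"
  by (simp add: word_product_def)

lemma word_product_Cons_apply [simp]:
  "word_product (k # as) x = simple_transposition k (word_product as x)"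
  by (simp add: word_product_Cons)

lemma word_product_append_apply [simp]:
  "word_product (as @ bs) x = word_product as (word_product bs x)"
  by (induction as) auto

lemma simple_transposition_apply:
  "simple_transposition k x = (if x = k then k + 1 else if x = k + 1 then k else x)"
  by (auto simp: simple_transposition_def transpose_def)

lemma simple_transposition_involutive [simp]:
  "simple_transposition k (simple_transposition k x) = x"
  by (simp add: simple_transposition_apply)

lemma bij_simple_transposition [simp]: "bij (simple_transposition k)"
  by (simp add: simple_transposition_def)

lemma bij_word_product [simp]: "bij (word_product as)"
  by (induction as) (simp_all only: word_product_Nil bij_id word_product_Cons bij_comp bij_simple_transposition)

lemma word_product_eq_iff [simp]: "word_product as x = word_product as y \<longleftrightarrow> x = y"
  using bij_word_product[of as] by (metis bij_is_inj injD)

lemma word_product_rev_apply [simp]: "word_product (rev as) (word_product as x) = x"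
  by (induction as arbitrary: x) auto

lemma word_product_permutes:
  assumes "set as \<subseteq> {m..}"
  shows "word_product as permutes {m..}"
  using assms
proof (induction as)
  case (Cons k as)
  have "simple_transposition k permutes {m..}"
    unfolding simple_transposition_def using Cons.prems by (intro permutes_swap_id) auto
  with Cons show ?case unfolding word_product_Cons by (intro permutes_compose) auto
qed (simp add: permutes_id)

lemma word_product_le: "\<forall>k\<in>set as. k < m \<Longrightarrow> x \<le> m \<Longrightarrow> word_product as x \<le> m"
  by (induction as) (auto simp: simple_transposition_apply)

lemma word_product_fixes: "\<forall>k\<in>set as. x \<noteq> k \<and> x \<noteq> k + 1 \<Longrightarrow> word_product as x = x"
  by (induction as) (auto simp: simple_transposition_apply)

lemma word_product_ge: "\<forall>k\<in>set as. m \<le> k \<Longrightarrow> m \<le> x \<Longrightarrow> m \<le> word_product as x"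
  by (induction as) (auto simp: simple_transposition_apply)

lemma word_product_commute:
  "\<forall>l\<in>set as. l + 1 < k \<or> k + 1 < l \<Longrightarrow>
    simple_transposition k \<circ> word_product as = word_product as \<circ> simple_transposition k"
proof (induction as)
  case (Cons l as)
  have "simple_transposition k (simple_transposition l x) = simple_transposition l (simple_transposition k x)" for x
    using Cons.prems by (auto simp: simple_transposition_apply)
  then show ?case using Cons by (auto simp: fun_eq_iff)
qed simp

section \<open>Inversions and reduced words\<close>

definition inversions :: "(nat \<Rightarrow> nat) \<Rightarrow> (nat \<times> nat) set" where
  "inversions f = {(x, y). x < y \<and> f y < f x}"

lemma inversions_simple_transposition_up:
  assumes f: "inj f" "f x = k" "f y = k + 1" and "x < y"
  shows "inversions (simple_transposition k \<circ> f) = insert (x, y) (inversions f)"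
    and "(x, y) \<notin> inversions f"
proof -
  have X: "f p = k \<longleftrightarrow> p = x" "f p = k + 1 \<longleftrightarrow> p = y" for p
    using f by (metis injD)+
  have "(p, q) \<in> inversions (simple_transposition k \<circ> f) \<longleftrightarrow> (p, q) \<in> insert (x, y) (inversions f)"
    for p q
    using X[of p] X[of q] \<open>x < y\<close> by (auto simp: inversions_def simple_transposition_apply)
  then show "inversions (simple_transposition k \<circ> f) = insert (x, y) (inversions f)" by auto
  show "(x, y) \<notin> inversions f" using assms by (auto simp: inversions_def)
qed

text \<open>The converse step of the previous lemma: multiplying by the same letter once more restores \<open>f\<close>.\<close>

lemma inversions_simple_transposition_down:
  assumes f: "inj f" "f x = k" "f y = k + 1" and "y < x"
  shows "inversions f = insert (y, x) (inversions (simple_transposition k \<circ> f))"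
    and "(y, x) \<notin> inversions (simple_transposition k \<circ> f)"
proof -
  let ?g = "simple_transposition k \<circ> f"
  have g: "inj ?g" "?g y = k" "?g x = k + 1"
    using f bij_is_inj[OF bij_simple_transposition] by (auto simp: simple_transposition_apply intro: inj_compose)
  have "simple_transposition k \<circ> ?g = f"
    by (auto simp: simple_transposition_apply)
  then show "inversions f = insert (y, x) (inversions ?g)" "(y, x) \<notin> inversions ?g"
    using inversions_simple_transposition_up[OF g \<open>y < x\<close>] by metis+
qed

lemma finite_inversions_card_le:
  "finite (inversions (word_product as)) \<and> card (inversions (word_product as)) \<le> length as"
proof (induction as)
  case (Cons k as)
  let ?f = "word_product as"
  have inj: "inj ?f" and surj: "surj ?f" by (simp_all add: bij_is_inj bij_is_surj)
  obtain x y where xy: "?f x = k" "?f y = k + 1" using surj by (metis surjD)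
  then have "x \<noteq> y" by auto
  then consider "x < y" | "y < x" by linarith
  then show ?case
  proof cases
    case 1
    with inversions_simple_transposition_up[OF inj xy 1, folded word_product_Cons] Cons
    show ?thesis by (simp del: word_product_Cons_apply)
  next
    case 2
    with inversions_simple_transposition_down[OF inj xy 2] Cons show ?thesis
      by (metis (no_types, lifting) finite_insert card_insert_le le_SucI le_trans length_Cons word_product_Cons)
  qed
next
  case Nil
  have "inversions (word_product []) = {}" by (auto simp: inversions_def)
  then show ?case by (metis card.empty finite.emptyI le0)
qed

lemmas finite_inversions [simp] = finite_inversions_card_le[THEN conjunct1]
lemmas card_inversions_le = finite_inversions_card_le[THEN conjunct2]

definition reduced :: "nat list \<Rightarrow> bool" where
  "reduced as \<longleftrightarrow> card (inversions (word_product as)) = length as"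

text \<open>The product of a word has at most as many inversions as the word has letters. A word that attains
this bound cannot afford a letter that removes an inversion, so
every letter crosses two pipes \<open>x < y\<close> that have not crossed before.\<close>

lemma reduced_ConsE:
  assumes "reduced (k # as)" "word_product as x = k" "word_product as y = k + 1"
  shows "reduced as" "x < y"
    "inversions (word_product (k # as)) = insert (x, y) (inversions (word_product as))"
proof -
  let ?f = "word_product as"
  have inj: "inj ?f" by (simp_all add: bij_is_inj)
  show *: "x < y"
  proof (rule ccontr)
    assume "\<not> x < y"
    then have "y < x" using assms by (cases "x = y") auto
    from inversions_simple_transposition_down[OF inj assms(2,3) this]
    have "card (inversions (word_product (k # as))) < card (inversions ?f)"
      by (metis card_insert_disjoint finite_inversions lessI word_product_Cons)
    with assms(1) card_inversions_le[of as] show False by (auto simp: reduced_def)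
  qed
  note up = inversions_simple_transposition_up[OF inj assms(2,3) this]
  show "inversions (word_product (k # as)) = insert (x, y) (inversions (word_product as))"
    using up by (simp add: word_product_Cons)
  show "reduced as" using up assms(1) by (simp add: reduced_def word_product_Cons)
qed

text \<open>Since no letter removes an inversion, pipes crossed by a suffix of a reduced word are still crossed
at the end. This is how inversions of \<open>w\<close> are read off from parts of a reading word.\<close>

lemma reduced_append:
  assumes "reduced (as @ bs)"
  shows "reduced bs \<and> inversions (word_product bs) \<subseteq> inversions (word_product (as @ bs))"
  using assms
proof (induction as)
  case (Cons k as)
  have "surj (word_product (as @ bs))" using bij_is_surj bij_word_product by blast
  then obtain x y where xy: "word_product (as @ bs) x = k" "word_product (as @ bs) y = k + 1"
    by (metis surjD)
  have "reduced (k # (as @ bs))" using Cons.prems by simp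
  from reduced_ConsE[OF this xy] Cons.IH show ?case by (metis append_Cons subset_insertI2)
qed simp

section \<open>Reading words row by row\<close>

text \<open>The part of a row that lies in the columns from \<open>a\<close> to \<open>b - 1\<close>. Cutting rows at
columns makes local changes of a graph visible in its reading word.\<close>

definition row_segment :: "(nat \<times> nat) set \<Rightarrow> nat \<Rightarrow> nat \<Rightarrow> nat \<Rightarrow> nat list" where
  "row_segment D i a b = map (\<lambda>j. i + j - 1) (rev (filter (\<lambda>j. (i, j) \<in> D) [a..<b]))"

definition rows_word :: "(nat \<times> nat) set \<Rightarrow> nat \<Rightarrow> nat \<Rightarrow> nat list" where
  "rows_word D m n = concat (map (row_word D) [m..<n])"

lemma upt_split: "a \<le> b \<Longrightarrow> b \<le> c \<Longrightarrow> [a..<c] = [a..<b] @ [b..<c]"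
  using upt_add_eq_append[of a b "c - b"] by simp

lemma row_segment_split:
  "a \<le> b \<Longrightarrow> b \<le> c \<Longrightarrow> row_segment D i a c = row_segment D i b c @ row_segment D i a b"
  by (simp add: row_segment_def upt_split[of a b c])

lemma row_segment_Suc:
  "a \<le> b \<Longrightarrow> row_segment D i a (Suc b) = (if (i, b) \<in> D then [i + b - 1] else []) @ row_segment D i a b"
  by (simp add: row_segment_def)

lemma set_row_segment: "set (row_segment D i a b) = {i + j - 1 | j. a \<le> j \<and> j < b \<and> (i, j) \<in> D}"
  by (auto simp: row_segment_def)

lemma row_segment_cong:
  "(\<And>j. a \<le> j \<Longrightarrow> j < b \<Longrightarrow> (i, j) \<in> D \<longleftrightarrow> (i, j) \<in> E) \<Longrightarrow> row_segment D i a b = row_segment E i a b"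
  unfolding row_segment_def by (intro arg_cong[where f = "map _"] arg_cong[where f = rev] filter_cong) auto

lemma row_segment_full:
  assumes "\<And>j. 1 \<le> j \<Longrightarrow> j \<le> c \<Longrightarrow> (i, j) \<in> D"
  shows "row_segment D i 1 (Suc c) = rev [i..<i + c]"
  using assms
proof (induction c)
  case (Suc c)
  then show ?case by (simp add: row_segment_Suc)
qed (simp add: row_segment_def)

lemma row_segment_empty:
  assumes "\<And>j. a \<le> j \<Longrightarrow> j < b \<Longrightarrow> (i, j) \<notin> D"
  shows "row_segment D i a b = []"
  using assms by (auto simp: row_segment_def filter_empty_conv)

lemma row_word_eq_row_segment:
  assumes "\<And>j. (i, j) \<in> D \<Longrightarrow> 1 \<le> j \<and> j < M"
  shows "row_word D i = row_segment D i 1 M"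
proof -
  have "{j. (i, j) \<in> D} = set (filter (\<lambda>j. (i, j) \<in> D) [1..<M])" using assms by auto
  moreover have "sorted_list_of_set (set (filter (\<lambda>j. (i, j) \<in> D) [1..<M])) = filter (\<lambda>j. (i, j) \<in> D) [1..<M]"
    by (rule sorted_list_of_set.idem_if_sorted_distinct) (simp_all add: sorted_wrt_filter)
  ultimately show ?thesis by (simp add: row_word_def row_segment_def)
qed

lemma row_word_cong: "(\<And>j. (i, j) \<in> D \<longleftrightarrow> (i, j) \<in> E) \<Longrightarrow> row_word D i = row_word E i"
  by (simp add: row_word_def)

lemma rows_word_cong:
  "(\<And>i j. m \<le> i \<Longrightarrow> i < n \<Longrightarrow> (i, j) \<in> D \<longleftrightarrow> (i, j) \<in> E) \<Longrightarrow> rows_word D m n = rows_word E m n"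
  unfolding rows_word_def by (intro arg_cong[where f = concat] map_cong refl row_word_cong) auto

lemma rows_word_split: "m \<le> k \<Longrightarrow> k \<le> n \<Longrightarrow> rows_word D m n = rows_word D m k @ rows_word D k n"
  by (simp add: rows_word_def upt_split[of m k n])

lemma rows_word_Cons: "m < n \<Longrightarrow> rows_word D m n = row_word D m @ rows_word D (Suc m) n"
  by (simp add: rows_word_def upt_conv_Cons)

lemma concat_map_filter_Nil: "(\<And>x. x \<in> set xs \<Longrightarrow> \<not> P x \<Longrightarrow> g x = []) \<Longrightarrow> concat (map g (filter P xs)) = concat (map g xs)"
  by (induction xs) auto

text \<open>Empty rows contribute the empty word, so the nonempty rows may be replaced by an initial segment.\<close>

lemma reading_word_eq_rows_word:
  assumes "fst ` D \<subseteq> {1..<N}"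
  shows "reading_word D = rows_word D 1 N"
proof -
  have "fst ` D = set (filter (\<lambda>i. i \<in> fst ` D) [1..<N])" using assms by auto
  moreover have "sorted_list_of_set (set (filter (\<lambda>i. i \<in> fst ` D) [1..<N])) = filter (\<lambda>i. i \<in> fst ` D) [1..<N]"
    by (rule sorted_list_of_set.idem_if_sorted_distinct) (simp_all add: sorted_wrt_filter)
  ultimately have *: "sorted_list_of_set (fst ` D) = filter (\<lambda>i. i \<in> fst ` D) [1..<N]" by metis
  have "row_word D i = []" if "i \<notin> fst ` D" for i
  proof -
    from that have "{j. (i, j) \<in> D} = {}" by force
    then show ?thesis by (simp add: row_word_def)
  qed
  then show ?thesis
    unfolding reading_word_def rows_word_def * by (intro concat_map_filter_Nil) auto
qed

lemma length_reading_word: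
  assumes "finite D"
  shows "length (reading_word D) = card D"
proof -
  have fin: "finite {j. (i, j) \<in> D}" for i
  proof (rule finite_subset)
    show "{j. (i, j) \<in> D} \<subseteq> snd ` D" by force
  qed (use assms in simp)
  have "D = Sigma (fst ` D) (\<lambda>i. {j. (i, j) \<in> D})" by force
  then have "card D = card (Sigma (fst ` D) (\<lambda>i. {j. (i, j) \<in> D}))" by simp
  also have "\<dots> = (\<Sum>i\<in>fst ` D. card {j. (i, j) \<in> D})"
    using assms fin by (intro card_SigmaI) auto
  also have "\<dots> = sum_list (map (\<lambda>i. card {j. (i, j) \<in> D}) (sorted_list_of_set (fst ` D)))"
    using assms by (simp add: sum_list_distinct_conv_sum_set)
  also have "\<dots> = length (reading_word D)"
    using fin by (simp add: reading_word_def length_concat comp_def row_word_def)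
  finally show ?thesis by simp
qed

lemma rows_word_ge:
  assumes "D \<subseteq> {1..} \<times> {1..}" "finite D"
  shows "set (rows_word D m n) \<subseteq> {m..}"
proof
  fix k assume "k \<in> set (rows_word D m n)"
  then obtain i where i: "m \<le> i" "k \<in> set (row_word D i)" by (auto simp: rows_word_def)
  have "finite {j. (i, j) \<in> D}"
  proof (rule finite_subset)
    show "{j. (i, j) \<in> D} \<subseteq> snd ` D" by force
  qed (use assms in simp)
  with i obtain j where "k = i + j - 1" "(i, j) \<in> D" by (auto simp: row_word_def)
  with assms i show "k \<in> {m..}" by auto
qed

section \<open>The Lehmer code and the Coxeter length\<close>

text \<open>The Lehmer code of \<open>p\<close>. In \<open>code_word\<close>, row \<open>i\<close> is left-justified with \<open>c i\<close> crossings.\<close>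

definition code :: "(nat \<Rightarrow> nat) \<Rightarrow> nat \<Rightarrow> nat" where
  "code p x = card {y. x < y \<and> p y < p x}"

definition code_word :: "(nat \<Rightarrow> nat) \<Rightarrow> nat \<Rightarrow> nat \<Rightarrow> nat list" where
  "code_word c m n = concat (map (\<lambda>i. rev [i..<i + c i]) [m..<n])"

text \<open>A left-justified row carries the pipe \<open>i\<close> past \<open>c\<close> others, each of which moves back by one.\<close>

lemma word_product_rev_upt:
  "word_product (rev [i..<i + c]) x = (if x = i then i + c else if i < x \<and> x \<le> i + c then x - 1 else x)"
  by (induction c) (auto simp: simple_transposition_apply)

lemma code_word_cong:
  "(\<And>i. m \<le> i \<Longrightarrow> i < n \<Longrightarrow> c i = d i) \<Longrightarrow> code_word c m n = code_word d m n"
  unfolding code_word_def by (intro arg_cong[where f = concat] map_cong refl) auto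

lemma code_word_split: "m \<le> k \<Longrightarrow> k \<le> n \<Longrightarrow> code_word c m n = code_word c m k @ code_word c k n"
  by (simp add: code_word_def upt_split[of m k n])

lemma code_word_Cons: "m < n \<Longrightarrow> code_word c m n = rev [m..<m + c m] @ code_word c (Suc m) n"
  by (simp add: code_word_def upt_conv_Cons)

lemma code_word_ge: "set (code_word c m n) \<subseteq> {m..}"
  by (auto simp: code_word_def)

lemma code_cong_order:
  assumes "\<And>y. x < y \<Longrightarrow> p y < p x \<longleftrightarrow> q y < q x"
  shows "code p x = code q x"
  unfolding code_def using assms by (intro arg_cong[where f = card]) auto

lemma code_first:
  assumes p: "p permutes {m..}"
  shows "p m = m + code p m"
proof -
  have "m \<le> p m" using permutes_in_image[OF p, of m] by simp
  have inj: "inj p" using p by (rule permutes_inj)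
  have "p ` {y. m < y \<and> p y < p m} = {m..<p m}"
  proof (intro equalityI subsetI)
    fix z assume "z \<in> p ` {y. m < y \<and> p y < p m}"
    then obtain y where "z = p y" "m < y" "p y < p m" by auto
    then show "z \<in> {m..<p m}" using permutes_in_image[OF p, of y] by simp
  next
    fix z assume z: "z \<in> {m..<p m}"
    then obtain y where y: "p y = z" using permutes_surj[OF p] by (metis surjD)
    then have "m \<le> y" using permutes_in_image[OF p, of y] z by auto
    moreover have "y \<noteq> m" using y z by auto
    ultimately have "y \<in> {y. m < y \<and> p y < p m}" using y z by simp
    then show "z \<in> p ` {y. m < y \<and> p y < p m}" using y by blast
  qed
  then have "code p m = card {m..<p m}"
    unfolding code_def using card_image[OF inj_on_subset[OF inj subset_UNIV]] by metis
  with \<open>m \<le> p m\<close> show ?thesis by simp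
qed

text \<open>Peeling off the first row \<open>Q\<close> leaves a permutation that fixes \<open>m\<close> as well and has the
same code beyond \<open>m\<close>, because \<open>Q\<close> preserves the order of all values other than its image of \<open>m\<close>.\<close>

lemma code_word_product:
  assumes "p permutes {m..}" "\<And>x. n \<le> x \<Longrightarrow> p x = x" "m \<le> n"
  shows "word_product (code_word (code p) m n) = p"
  using assms
proof (induction "n - m" arbitrary: m p)
  case 0
  have "p x = x" for x using 0 permutes_not_in[OF 0(2), of x] by (cases "x < m") auto
  then have "p = id" by auto
  with 0 show ?case by (simp add: code_word_def id_def)
next
  case (Suc l)
  then have "m < n" by simp
  define c where "c = code p m"
  define Q where "Q = word_product (rev [m..<m + c])"
  define p' where "p' = word_product (rev (rev [m..<m + c])) \<circ> p"
  note Q = word_product_rev_upt[of m c, folded Q_def]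
  have pm: "p m = m + c" using code_first[OF Suc.prems(1)] by (simp add: c_def)
  have Qp': "Q (p' x) = p x" for x
    using word_product_rev_apply[of "rev (rev [m..<m + c])"] by (simp add: Q_def p'_def)
  have injQ: "Q x = Q y \<longleftrightarrow> x = y" for x y by (simp add: Q_def)
  have bij: "p' permutes {m..}" unfolding p'_def
    using Suc.prems(1) by (intro permutes_compose[OF _ word_product_permutes]) auto
  have p'm: "p' m = m" using Qp'[of m] pm by (metis Q injQ)
  have perm': "p' permutes {Suc m..}"
  proof (rule permutes_superset[OF bij])
    show "p' x = x" if "x \<in> {m..} - {Suc m..}" for x
    proof -
      have "x = m" using that by auto
      then show ?thesis using p'm by simp
    qed
  qed
  have "p m < n"
  proof (rule ccontr)
    assume "\<not> p m < n"
    then have "p (p m) = p m" using Suc.prems(2) by simp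
    then have "p m = m" using permutes_inj[OF Suc.prems(1)] by (simp add: inj_eq)
    with \<open>\<not> p m < n\<close> \<open>m < n\<close> show False by simp
  qed
  then have fix': "p' x = x" if "n \<le> x" for x
  proof -
    have "Q x = x" using that \<open>p m < n\<close> pm by (simp add: Q)
    then have "Q (p' x) = Q x" using Qp'[of x] Suc.prems(2)[OF that] by simp
    then show ?thesis by (simp only: injQ)
  qed
  have "word_product (code_word (code p') (Suc m) n) = p'"
    using Suc.hyps(2) \<open>m < n\<close> perm' fix' by (intro Suc.hyps(1)) auto
  moreover have "code_word (code p') (Suc m) n = code_word (code p) (Suc m) n"
  proof (intro code_word_cong code_cong_order)
    fix x y assume "Suc m \<le> x" "x < y"
    then have "m < p' x" "m < p' y" using permutes_in_image[OF perm', of x] permutes_in_image[OF perm', of y] by auto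
    then show "p' y < p' x \<longleftrightarrow> p y < p x"
      unfolding Qp'[symmetric] Q by auto
  qed
  ultimately have "word_product (code_word (code p) m n) x = Q (p' x)" for x
    using \<open>m < n\<close> by (simp add: code_word_Cons Q_def c_def)
  then show ?case using Qp' by auto
qed

lemma length_code_word: "length (code_word c m n) = (\<Sum>x\<in>{m..<n}. c x)"
  by (simp add: code_word_def length_concat comp_def sum_list_distinct_conv_sum_set)

lemma finite_smaller_values:
  assumes "inj p"
  shows "finite {y. (x::nat) < y \<and> p y < (p x :: nat)}"
proof (rule finite_subset)
  show "{y. x < y \<and> p y < p x} \<subseteq> p -` {..<p x}" by auto
  show "finite (p -` {..<p x})" using assms by (intro finite_vimageI) auto
qed

lemma card_inversions_eq_sum_code:
  assumes p: "p permutes {m..}" and fixed: "\<And>x. n \<le> x \<Longrightarrow> p x = x"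
  shows "card (inversions p) = (\<Sum>x\<in>{m..<n}. code p x)"
proof -
  have inj: "inj p" using p by (rule permutes_inj)
  have range: "m \<le> x \<and> x < n" if "x < y" "p y < p x" for x y
  proof -
    have "m \<le> x"
    proof (rule ccontr)
      assume "\<not> m \<le> x"
      then have "p x = x" using p by (auto simp: permutes_def)
      with that \<open>\<not> m \<le> x\<close> have "p y < m" by simp
      then have "p (p y) = p y" using p by (auto simp: permutes_def)
      then have "p y = y" using inj by (auto dest: injD)
      with that \<open>p x = x\<close> show False by simp
    qed
    moreover have "x < n" using that fixed[of x] fixed[of y] by (metis le_trans less_imp_le linorder_not_less)
    ultimately show ?thesis ..
  qed
  then have "inversions p = Sigma {m..<n} (\<lambda>x. {y. x < y \<and> p y < p x})"
    unfolding inversions_def by fastforce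
  then show ?thesis
    using finite_smaller_values[OF inj] by (simp add: code_def card_SigmaI)
qed

text \<open>Both the length of the code word and the number of inversions are the sum of the code. Hence code
words realise the lower bound of \<open>card_inversions_le\<close>, which identifies the Coxeter length.\<close>

lemma reduced_code_word:
  assumes "p permutes {m..}" "\<And>x. n \<le> x \<Longrightarrow> p x = x" "m \<le> n"
  shows "reduced (code_word (code p) m n)"
  using code_word_product[OF assms] card_inversions_eq_sum_code[OF assms(1,2)]
  by (simp add: reduced_def length_code_word)

lemma S_infinityE:
  assumes "w \<in> S_infinity"
  obtains N where "w permutes {1..}" "1 \<le> N" "\<forall>x\<ge>N. w x = x"
proof -
  have "finite {i. w i \<noteq> i}" using assms by (simp add: S_infinity_def)
  then obtain N where "\<forall>i\<in>{i. w i \<noteq> i}. i < N" using finite_nat_set_iff_bounded by blast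
  then have "w x = x" if "N + 1 \<le> x" for x using that by force
  with that[of "N + 1"] assms show ?thesis by (simp add: S_infinity_def)
qed

lemma coxeter_length_eq_card_inversions:
  assumes "w \<in> S_infinity"
  shows "coxeter_length w = card (inversions w)"
proof -
  obtain N where "w permutes {1..}" "1 \<le> N" "\<forall>x\<ge>N. w x = x"
    by (rule S_infinityE[OF assms])
  then have N: "w permutes {1..}" "1 \<le> N" "\<And>x. N \<le> x \<Longrightarrow> w x = x" by auto
  note cw = code_word_product[OF N(1,3,2)] reduced_code_word[OF N(1,3,2)]
  show ?thesis unfolding coxeter_length_def
  proof (rule Least_equality)
    show "\<exists>as. set as \<subseteq> {1..} \<and> length as = card (inversions w) \<and> word_product as = w"
      using cw code_word_ge[of "code w" 1 N] by (auto simp: reduced_def)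
  next
    fix n assume "\<exists>as. set as \<subseteq> {1..} \<and> length as = n \<and> word_product as = w"
    then show "card (inversions w) \<le> n" using card_inversions_le by blast
  qed
qed

lemma mem_rc_graphs_iff:
  assumes "w \<in> S_infinity"
  shows "D \<in> rc_graphs w \<longleftrightarrow> finite D \<and> D \<subseteq> {1..} \<times> {1..} \<and>
    word_product (reading_word D) = w \<and> reduced (reading_word D)"
  using coxeter_length_eq_card_inversions[OF assms]
  by (auto simp: rc_graphs_def reduced_def length_reading_word)

section \<open>Left-justified RC-graphs\<close>

definition left_justified :: "(nat \<times> nat) set \<Rightarrow> bool" where
  "left_justified D \<longleftrightarrow> (\<forall>i j. 1 \<le> j \<longrightarrow> (i, j + 1) \<in> D \<longrightarrow> (i, j) \<in> D)"

lemma finite_nat_relation_bounded: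
  assumes "finite (D :: (nat \<times> nat) set)"
  obtains N where "\<And>i j. (i, j) \<in> D \<Longrightarrow> i < N \<and> j < N"
proof -
  have "finite (fst ` D \<union> snd ` D)" using assms by simp
  then obtain N where "\<forall>n\<in>fst ` D \<union> snd ` D. n < N" using finite_nat_set_iff_bounded by blast
  then show ?thesis using that[of N] by force
qed

text \<open>The rows after row \<open>m\<close> fix \<open>m\<close>, so the image of \<open>m\<close> is \<open>m + c m\<close>: the product determines the
first row, and then all others by cancellation.\<close>

lemma code_word_inj:
  assumes "word_product (code_word c m n) = word_product (code_word d m n)" "m \<le> i" "i < n"
  shows "c i = d i"
  using assms
proof (induction "i - m" arbitrary: m)
  case 0
  then have "m < n" "i = m" by auto
  have "word_product (code_word c (Suc m) n) m = m" for c
    using code_word_ge[of c "Suc m" n] by (intro word_product_fixes) force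
  then have "word_product (code_word c m n) m = m + c m" for c
    using \<open>m < n\<close> by (simp add: code_word_Cons word_product_rev_upt)
  from this[of c] this[of d] show ?case using 0(2) \<open>i = m\<close> by simp
next
  case (Suc l)
  then have "m < n" by simp
  have fixes_m: "word_product (code_word c (Suc m) n) m = m" for c
    using code_word_ge[of c "Suc m" n] by (intro word_product_fixes) force
  then have "word_product (code_word c m n) m = m + c m" for c
    using \<open>m < n\<close> by (simp add: code_word_Cons word_product_rev_upt)
  from this[of c] this[of d] have "c m = d m" using Suc.prems by simp
  have eq: "word_product (code_word c (Suc m) n) = word_product (code_word d (Suc m) n)"
  proof
    show "word_product (code_word c (Suc m) n) x = word_product (code_word d (Suc m) n) x" for x
      using fun_cong[OF Suc.prems(1), of x] \<open>m < n\<close> \<open>c m = d m\<close> by (simp add: code_word_Cons)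
  qed
  have "l = i - Suc m" "Suc m \<le> i" using Suc.hyps(2) by auto
  then show ?case using Suc.hyps(1)[OF _ eq] Suc.prems(3) by simp
qed

lemma left_justified_row:
  assumes "left_justified D" "finite D" "D \<subseteq> {1..} \<times> {1..}"
  shows "(i, j) \<in> D \<longleftrightarrow> 1 \<le> j \<and> j \<le> card {j. (i, j) \<in> D}"
proof -
  let ?S = "{j. (i, j) \<in> D}"
  have fin: "finite ?S"
  proof (rule finite_subset)
    show "?S \<subseteq> snd ` D" by force
  qed (use assms in simp)
  have down: "(i, j - l) \<in> D" if "(i, j) \<in> D" "1 \<le> j - l" for j l
    using that
  proof (induction l)
    case (Suc l)
    then have "(i, (j - Suc l) + 1) \<in> D" by (simp add: Suc_diff_Suc)
    with Suc.prems(2) show ?case using assms(1) unfolding left_justified_def by blast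
  qed simp
  have "\<exists>c. ?S = {1..c}"
  proof (cases "?S = {}")
    case True
    then have "?S = {1..0}" by simp
    then show ?thesis ..
  next
    case False
    have M: "(i, Max ?S) \<in> D" using Max_in[OF fin False] by simp
    have "?S = {1..Max ?S}"
    proof (intro equalityI subsetI)
      fix l assume "l \<in> ?S"
      then show "l \<in> {1..Max ?S}" using assms(3) fin by auto
    next
      fix l assume "l \<in> {1..Max ?S}"
      then show "l \<in> ?S" using down[OF M, of "Max ?S - l"] by simp
    qed
    then show ?thesis ..
  qed
  then obtain c where "?S = {1..c}" ..
  then show ?thesis by (metis atLeastAtMost_iff card_atLeastAtMost diff_Suc_1 mem_Collect_eq)
qed

lemma left_justified_reading_word:
  assumes "left_justified D" "finite D" "D \<subseteq> {1..} \<times> {1..}" and N: "\<And>i j. (i, j) \<in> D \<Longrightarrow> i < N \<and> j < N"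
  shows "reading_word D = code_word (\<lambda>i. card {j. (i, j) \<in> D}) 1 N"
proof -
  note row = left_justified_row[OF assms(1-3)]
  have "row_word D i = rev [i..<i + card {j. (i, j) \<in> D}]" for i
  proof -
    let ?c = "card {j. (i, j) \<in> D}"
    have "row_word D i = row_segment D i 1 (Suc ?c)"
      by (intro row_word_eq_row_segment) (metis row less_Suc_eq_le)
    also have "\<dots> = rev [i..<i + ?c]"
      by (intro row_segment_full) (metis row)
    finally show ?thesis .
  qed
  then have "rows_word D 1 N = code_word (\<lambda>i. card {j. (i, j) \<in> D}) 1 N"
    unfolding rows_word_def code_word_def by (intro arg_cong[where f = concat] map_cong refl)
  moreover have "reading_word D = rows_word D 1 N"
    using assms(3) N by (intro reading_word_eq_rows_word) force
  ultimately show ?thesis by simp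
qed

lemma left_justified_rc_graph_unique:
  assumes "D \<in> rc_graphs w" "E \<in> rc_graphs w" "left_justified D" "left_justified E"
  shows "D = E"
proof -
  have D: "finite D" "D \<subseteq> {1..} \<times> {1..}" "word_product (reading_word D) = w"
    and E: "finite E" "E \<subseteq> {1..} \<times> {1..}" "word_product (reading_word E) = w"
    using assms(1,2) by (auto simp: rc_graphs_def)
  obtain N where N: "\<And>i j. (i, j) \<in> D \<union> E \<Longrightarrow> i < N \<and> j < N"
    using finite_nat_relation_bounded[of "D \<union> E"] D E by blast
  have "word_product (code_word (\<lambda>i. card {j. (i, j) \<in> D}) 1 N) =
      word_product (code_word (\<lambda>i. card {j. (i, j) \<in> E}) 1 N)"
    using left_justified_reading_word[OF assms(3) D(1,2) N]
      left_justified_reading_word[OF assms(4) E(1,2) N] D(3) E(3) by simp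
  from code_word_inj[OF this]
  have eq: "card {j. (i, j) \<in> D} = card {j. (i, j) \<in> E}" if "1 \<le> i" "i < N" for i using that .
  have "(i, j) \<in> D \<longleftrightarrow> (i, j) \<in> E" for i j
  proof (cases "1 \<le> i \<and> i < N")
    case True
    then show ?thesis
      using eq left_justified_row[OF assms(3) D(1,2), of i j] left_justified_row[OF assms(4) E(1,2), of i j]
      by simp
  next
    case False
    then show ?thesis using N D(2) E(2) by blast
  qed
  then show ?thesis by auto
qed

section \<open>How often a pipe can be passed\<close>

text \<open>The letters are applied in increasing order. Before the largest letter \<open>k\<close> acts, the element \<open>k + 1\<close>
is still in place and everything above it is fixed, so \<open>k\<close> makes a smaller element pass a larger one only when the
larger one is \<open>k + 1\<close>, and then exactly one element passes it. In terms of pipes: going up through a row, a pipe is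
crossed from the left at most once, since it is vertical in at most one crossing of the row.\<close>

lemma decreasing_word_overtakes_once:
  assumes "sorted_wrt (>) as" "y < q" "word_product as q < word_product as y"
    "y' < q" "word_product as q < word_product as y'"
  shows "y = y'"
  using assms
proof (induction as)
  case (Cons k as)
  let ?F = "word_product as"
  have letters: "\<forall>l\<in>set as. l < k" using Cons.prems(1) by auto
  have above: "?F z = z" if "k < z" for z using letters that by (intro word_product_fixes) force
  have below: "?F z \<le> k" if "z \<le> k" for z using letters that by (rule word_product_le)
  have inj: "?F z = ?F z' \<longleftrightarrow> z = z'" for z z' by simp
  have q: "?F q = k \<or> ?F q = k + 1 \<or> ?F q < k \<or> k + 1 < ?F q" by linarith
  have big: "k + 1 < ?F z \<longleftrightarrow> k + 1 < z" for z using above[of z] below[of z] by (cases "z \<le> k") auto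
  have mid: "?F z = k + 1 \<longleftrightarrow> z = k + 1" for z using above[of "k+1"] inj[of z "k+1"] by simp
  consider "q = k + 1" | "k + 1 < q" | "q \<le> k" "?F q = k" | "q \<le> k" "?F q < k"
    using below[of q] by linarith
  then show ?case
  proof cases
    case 1
    then have "?F q = k + 1" using mid by simp
    have "?F z = k" if "z < q" "word_product (k # as) q < word_product (k # as) z" for z
      using that below[of z] 1 mid[of z] big[of z] \<open>?F q = k + 1\<close>
      by (simp add: simple_transposition_apply split: if_splits)
    then have "?F y = ?F y'" using Cons.prems by metis
    then show ?thesis by simp
  next
    case 2
    then have "?F q = q" using above by simp
    with 2 Cons.prems(2,3) above[of y] below[of y] show ?thesis
      by (cases "y \<le> k") (auto simp: simple_transposition_apply split: if_splits)
  next
    case 3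
    with Cons.prems(2,3) big[of y] mid[of y] show ?thesis
      by (auto simp: simple_transposition_apply split: if_splits)
  next
    case 4
    have "?F q < ?F z" if "z < q" "word_product (k # as) q < word_product (k # as) z" for z
      using that 4 by (auto simp: simple_transposition_apply split: if_splits)
    then have "?F q < ?F y" "?F q < ?F y'" using Cons.prems(2-5) by blast+
    with Cons show ?thesis by simp
  qed
qed simp

text \<open>Each of the rows adds at most one pipe to those that have passed \<open>b\<close>.\<close>

lemma overtaking_bound:
  assumes "\<forall>as\<in>set rs. sorted_wrt (>) as" "finite X" "inj h"
  shows "card {x \<in> X. word_product (concat rs) (h b) < word_product (concat rs) (h x)}
    \<le> length rs + card {x \<in> X. h b < h x}"
  using assms(1)
proof (induction rs)
  case (Cons as rs)
  let ?H = "\<lambda>x. word_product (concat rs) (h x)" and ?R = "word_product as"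
  let ?new = "{x \<in> X. ?H x < ?H b \<and> ?R (?H b) < ?R (?H x)}"
  have fin: "finite ?new" using assms(2) by simp
  have "\<forall>x\<in>?new. \<forall>y\<in>?new. x = y"
  proof (intro ballI)
    fix x y assume "x \<in> ?new" "y \<in> ?new"
    then have "?H x = ?H y" using Cons.prems by (intro decreasing_word_overtakes_once[of as _ "?H b"]) auto
    then show "x = y" using assms(3) by (simp add: inj_eq)
  qed
  then have one: "card ?new \<le> 1" using card_le_Suc0_iff_eq[OF fin] by simp
  have "{x \<in> X. word_product (concat (as # rs)) (h b) < word_product (concat (as # rs)) (h x)}
      \<subseteq> ?new \<union> {x \<in> X. ?H b < ?H x}"
    using nat_neq_iff by fastforce
  then have "card {x \<in> X. word_product (concat (as # rs)) (h b) < word_product (concat (as # rs)) (h x)}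
      \<le> card (?new \<union> {x \<in> X. ?H b < ?H x})"
    using assms(2) by (intro card_mono) auto
  also have "\<dots> \<le> card ?new + card {x \<in> X. ?H b < ?H x}" by (rule card_Un_le)
  finally show ?case using one Cons by simp
qed simp

lemma row_word_decreasing:
  assumes "finite D" "D \<subseteq> {1..} \<times> {1..}"
  shows "sorted_wrt (>) (row_word D i)"
proof -
  obtain N where N: "\<And>i j. (i, j) \<in> D \<Longrightarrow> i < N \<and> j < N"
    using finite_nat_relation_bounded[OF assms(1)] by blast
  have "row_word D i = row_segment D i 1 N"
    using N assms(2) by (intro row_word_eq_row_segment) force
  moreover have "sorted_wrt (\<lambda>x y. i + x - 1 < i + y - (1::nat)) (filter (\<lambda>j. (i, j) \<in> D) [1..<N])"
    by (rule sorted_wrt_filter, rule sorted_wrt_mono_rel[of _ "(<)"]) auto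
  ultimately show ?thesis by (simp add: row_segment_def sorted_wrt_map sorted_wrt_rev)
qed

lemma row_word_around:
  assumes "\<And>j. (i, j) \<in> D \<Longrightarrow> 1 \<le> j \<and> j < M" "1 \<le> j" "j + 2 \<le> M"
  shows "row_word D i = row_segment D i (j + 2) M @ (if (i, j + 1) \<in> D then [i + j] else []) @
    (if (i, j) \<in> D then [i + j - 1] else []) @ row_segment D i 1 j"
proof -
  have "row_word D i = row_segment D i (j + 2) M @ row_segment D i 1 (Suc (Suc j))"
    using assms row_word_eq_row_segment[of i D M] row_segment_split[of 1 "j + 2" M D i] by simp
  then show ?thesis using assms(2) by (simp add: row_segment_Suc)
qed

text \<open>If the letters between two equal letters all commute with them, the two cancel.\<close>

lemma reduced_no_cancelling_pair:
  assumes "reduced (as @ [k] @ bs @ [k] @ cs)"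
  shows "\<exists>l\<in>set bs. \<not> (l + 1 < k \<or> k + 1 < l)"
proof (rule ccontr)
  assume "\<not> ?thesis"
  then have comm: "simple_transposition k \<circ> word_product bs = word_product bs \<circ> simple_transposition k"
    by (intro word_product_commute) auto
  have "word_product (as @ [k] @ bs @ [k] @ cs) x = word_product (as @ bs @ cs) x" for x
    using fun_cong[OF comm, of "simple_transposition k (word_product cs x)"] by simp
  then have "word_product (as @ [k] @ bs @ [k] @ cs) = word_product (as @ bs @ cs)" by blast
  with card_inversions_le[of "as @ bs @ cs"] assms show False by (simp add: reduced_def)
qed

lemma word_product_move_letter:
  assumes "\<And>l. l \<in> set bs \<Longrightarrow> l + 1 < k \<or> k + 1 < l"
  shows "word_product (as @ [k] @ bs @ cs) = word_product (as @ bs @ [k] @ cs)"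
proof
  fix x
  have comm: "simple_transposition k \<circ> word_product bs = word_product bs \<circ> simple_transposition k"
    using assms by (intro word_product_commute) auto
  show "word_product (as @ [k] @ bs @ cs) x = word_product (as @ bs @ [k] @ cs) x"
    using fun_cong[OF comm, of "word_product cs x"] by simp
qed

section \<open>Moving towards the left-justified RC-graph\<close>

text \<open>The situation of the inductive step: \<open>j\<close> is the leftmost column with an empty cell beside a
crossing, and \<open>i\<close> is the lowest row where this happens in column \<open>j\<close>. The bound \<open>M\<close> exceeds all columns, and all
rows by at least two, so that row \<open>i + 1\<close> is among the rows read.\<close>

locale rc_graph_gap =
  fixes w D i j M
  assumes w: "w \<in> S_infinity" and D: "D \<in> rc_graphs w"
    and gap: "1 \<le> j" "(i, j) \<notin> D" "(i, j + 1) \<in> D"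
    and left: "\<And>i' j'. 1 \<le> j' \<Longrightarrow> j' < j \<Longrightarrow> (i', j' + 1) \<in> D \<Longrightarrow> (i', j') \<in> D"
    and low: "\<And>i'. i < i' \<Longrightarrow> (i', j + 1) \<in> D \<Longrightarrow> (i', j) \<in> D"
    and M: "\<And>i j. (i, j) \<in> D \<Longrightarrow> i + 1 < M \<and> j < M"
begin

definition "P = rows_word D 1 i"
definition "C = rows_word D (i + 2) M"

lemma rc_graph_D: "finite D" "D \<subseteq> {1..} \<times> {1..}" "word_product (reading_word D) = w" "reduced (reading_word D)"
  using D mem_rc_graphs_iff[OF w] by auto

lemma i_bounds: "1 \<le> i" "i + 1 < M" "j + 2 \<le> M"
  using gap rc_graph_D(2) M[of i "j + 1"] by auto

text \<open>Only the rows \<open>i\<close> and \<open>i + 1\<close> are changed by the move, so the remaining factors \<open>P\<close> and \<open>C\<close> are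
shared by the graphs before and after it.\<close>

lemma reading_word_two_rows:
  assumes "E \<subseteq> {1..} \<times> {1..}" "\<And>i j. (i, j) \<in> E \<Longrightarrow> i < M \<and> j < M"
    "\<And>i' j'. i' \<noteq> i \<Longrightarrow> i' \<noteq> i + 1 \<Longrightarrow> (i', j') \<in> E \<longleftrightarrow> (i', j') \<in> D"
  shows "reading_word E = P @ row_word E i @ row_word E (i + 1) @ C"
proof -
  have "reading_word E = rows_word E 1 M"
    using assms(1,2) by (intro reading_word_eq_rows_word) force
  also have "\<dots> = rows_word E 1 i @ row_word E i @ row_word E (i + 1) @ rows_word E (i + 2) M"
    using i_bounds rows_word_split[of 1 i M E] rows_word_Cons[of i M E] rows_word_Cons[of "Suc i" M E] by simp
  also have "rows_word E 1 i = P" unfolding P_def using assms(3) by (intro rows_word_cong) auto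
  also have "rows_word E (i + 2) M = C" unfolding C_def using assms(3) by (intro rows_word_cong) auto
  finally show ?thesis .
qed

lemma reading_word_D: "reading_word D = P @ row_word D i @ row_word D (i + 1) @ C"
  using rc_graph_D(2) M by (intro reading_word_two_rows) force+

text \<open>The parts of the rows \<open>i\<close> and \<open>i + 1\<close> to the right and to the left of the columns \<open>j\<close> and \<open>j + 1\<close>.\<close>

abbreviation "hi \<equiv> row_segment D i (j + 2) M"
abbreviation "lo \<equiv> row_segment D i 1 j"
abbreviation "hi' \<equiv> row_segment D (i + 1) (j + 2) M"
abbreviation "lo' \<equiv> row_segment D (i + 1) 1 j"

lemma row_around: "row_word D i' = row_segment D i' (j + 2) M @ (if (i', j + 1) \<in> D then [i' + j] else []) @
    (if (i', j) \<in> D then [i' + j - 1] else []) @ row_segment D i' 1 j"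
  using gap(1) i_bounds rc_graph_D(2) M by (intro row_word_around) force+

lemma row_i: "row_word D i = hi @ [i + j] @ lo"
  using gap by (simp add: row_around)

lemma letters: "l \<in> set hi \<Longrightarrow> i + j + 1 \<le> l" "l \<in> set lo \<Longrightarrow> l + 2 \<le> i + j"
    "l \<in> set lo \<Longrightarrow> i \<le> l"  "l \<in> set hi' \<Longrightarrow> i + j + 2 \<le> l"
    "l \<in> set lo' \<Longrightarrow> i + 1 \<le> l"
  using i_bounds by (auto simp: set_row_segment)

text \<open>Otherwise the crossings \<open>(i, j + 1)\<close> and \<open>(i + 1, j)\<close> carry the same letter \<open>i + j\<close>, and everything
between them commutes with it.\<close>

lemma not_cross_elbow: "(i + 1, j + 1) \<notin> D \<Longrightarrow> (i + 1, j) \<notin> D"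
proof
  assume "(i + 1, j + 1) \<notin> D" "(i + 1, j) \<in> D"
  then have "row_word D (i + 1) = hi' @ [i + j] @ lo'" by (simp add: row_around)
  then have "reading_word D = (P @ hi) @ [i + j] @ (lo @ hi') @ [i + j] @ (lo' @ C)"
    using reading_word_D row_i by simp
  with rc_graph_D(4) have "\<exists>l\<in>set (lo @ hi'). \<not> (l + 1 < i + j \<or> i + j + 1 < l)"
    using reduced_no_cancelling_pair by metis
  then show False using letters by fastforce
qed

text \<open>The letter \<open>i + j\<close> commutes with all letters that are read between the old and the new place of the
crossing, so the product does not change. The sum of the columns drops by one; it is the measure for the induction.\<close>

lemma inverse_simple_ladder_move:
  assumes "(i + 1, j + 1) \<notin> D" "(i + 1, j) \<notin> D"
  defines "D' \<equiv> (D - {(i, j + 1)}) \<union> {(i + 1, j)}"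
  shows "simple_ladder_move w D' D" "D' \<in> rc_graphs w" "(\<Sum>(i, j)\<in>D'. j) < (\<Sum>(i, j)\<in>D. j)"
proof -
  have D'bound: "D' \<subseteq> {1..} \<times> {1..}" "finite D'" using rc_graph_D gap i_bounds by (auto simp: D'_def)
  have D'M: "(i', j') \<in> D' \<Longrightarrow> i' < M \<and> j' < M" for i' j' using M[of i' j'] i_bounds by (auto simp: D'_def)
  have mem: "(i', j') \<in> D' \<longleftrightarrow> (i', j') \<in> D" if "(i', j') \<noteq> (i, j + 1)" "(i', j') \<noteq> (i + 1, j)" for i' j'
    using that by (auto simp: D'_def)
  have row: "row_word D' i' = row_segment D i' (j + 2) M @ (if (i', j + 1) \<in> D' then [i' + j] else []) @
    (if (i', j) \<in> D' then [i' + j - 1] else []) @ row_segment D i' 1 j" for i'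
  proof -
    have "row_word D' i' = row_segment D' i' (j + 2) M @ (if (i', j + 1) \<in> D' then [i' + j] else []) @
      (if (i', j) \<in> D' then [i' + j - 1] else []) @ row_segment D' i' 1 j"
      using gap(1) i_bounds D'bound D'M by (intro row_word_around) force+
    moreover have "row_segment D' i' (j + 2) M = row_segment D i' (j + 2) M"
      "row_segment D' i' 1 j = row_segment D i' 1 j"
      by (auto intro!: row_segment_cong mem)
    ultimately show ?thesis by simp
  qed
  have rows: "row_word D' i = hi @ lo" "row_word D' (i + 1) = hi' @ [i + j] @ lo'"
    using assms(1) gap by (simp_all add: row) (simp_all add: D'_def)
  have "reading_word D' = P @ row_word D' i @ row_word D' (i + 1) @ C"
    using D'bound D'M mem by (intro reading_word_two_rows) auto
  then have wD': "reading_word D' = (P @ hi) @ (lo @ hi') @ [i + j] @ (lo' @ C)" using rows by simp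
  have "row_word D (i + 1) = hi' @ lo'" using assms by (simp add: row_around)
  then have wD: "reading_word D = (P @ hi) @ [i + j] @ (lo @ hi') @ (lo' @ C)"
    using reading_word_D row_i by simp
  have prod: "word_product (reading_word D') = word_product (reading_word D)"
    unfolding wD wD' using letters by (intro word_product_move_letter[symmetric]) fastforce
  have "length (reading_word D') = length (reading_word D)" unfolding wD wD' by simp
  with prod rc_graph_D D'bound show D': "D' \<in> rc_graphs w"
    by (simp add: mem_rc_graphs_iff[OF w] reduced_def)
  have "D = (D' - {(i + 1, j)}) \<union> {(i, j + 1)}" using assms gap by (auto simp: D'_def)
  moreover have "(i + 1, j) \<in> D'" "(i + 1, j + 1) \<notin> D'" "(i, j) \<notin> D'" "(i, j + 1) \<notin> D'"
    using assms gap by (auto simp: D'_def)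
  ultimately show "simple_ladder_move w D' D"
    unfolding simple_ladder_move_def using D' i_bounds
    by (intro conjI exI[of _ "i + 1"] exI[of _ j]) auto
  have "(\<Sum>(i, j)\<in>D'. j) = (\<Sum>(i, j)\<in>D - {(i, j + 1)}. j) + j"
    using rc_graph_D(1) assms(2) by (simp add: D'_def)
  moreover have "(\<Sum>(i, j)\<in>D. j) = (\<Sum>(i, j)\<in>D - {(i, j + 1)}. j) + (j + 1)"
    using rc_graph_D(1) gap(3) by (simp add: sum.remove)
  ultimately show "(\<Sum>(i, j)\<in>D'. j) < (\<Sum>(i, j)\<in>D. j)" by linarith
qed

text \<open>Row \<open>i + 1\<close> starts with \<open>j + 1\<close> crossings. The pattern is formed by some \<open>x \<le> i\<close>, by the
pipe \<open>i + 1\<close> of that row and by the pipes \<open>c\<close>, \<open>b\<close> that enter it from below in the columns \<open>j\<close> and \<open>j + 1\<close>.\<close>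

lemma double_cross_1432:
  assumes "(i + 1, j + 1) \<in> D" "(i + 1, j) \<in> D"
  shows "\<not> avoids_1432 w"
proof -
  let ?f = "word_product C" and ?Q = "word_product (rev [i + 1..<i + 1 + (j + 1)])"
  let ?g = "word_product (row_word D (i + 1) @ C)"
  let ?h = "word_product (row_word D i @ row_word D (i + 1) @ C)"
  have "(i + 1, j - l) \<in> D" if "l < j" for l
    using that
  proof (induction l)
    case (Suc l)
    then show ?case using left[of "j - Suc l" "i + 1"] by (simp add: Suc_diff_Suc)
  qed (use assms in simp)
  then have "(i + 1, l) \<in> D" if "1 \<le> l" "l \<le> j" for l
    using that by (metis diff_diff_cancel diff_less less_le_trans zero_less_one)
  with assms(1) have full: "(i + 1, l) \<in> D" if "1 \<le> l" "l \<le> j + 1" for l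
    using that by (cases "l = j + 1") auto
  have "row_word D (i + 1) = row_segment D (i + 1) 1 M"
    using rc_graph_D(2) M by (intro row_word_eq_row_segment) force
  also have "\<dots> = hi' @ rev [i + 1..<i + 1 + (j + 1)]"
    using row_segment_split[of 1 "j + 2" M D "i + 1"] row_segment_full[of "j + 1" "i + 1" D] full i_bounds
    by simp
  finally have row: "row_word D (i + 1) = hi' @ rev [i + 1..<i + 1 + (j + 1)]" .
  have C_ge: "set C \<subseteq> {i + 2..}"
    unfolding C_def using rc_graph_D by (intro rows_word_ge)
  have f_fixes: "?f x = x" if "x < i + 2" for x
    using that C_ge by (intro word_product_fixes) force
  have "surj ?f" by (simp add: bij_is_surj)
  then obtain b c where bc: "?f b = i + j + 2" "?f c = i + j + 1" by (metis surjD)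
  have c_gt: "i + 1 < c" and b_gt: "i + 1 < b"
    using f_fixes[of b] f_fixes[of c] bc gap(1) by (force intro: ccontr)+
  have hi'_fixes: "word_product hi' x = x" if "x < i + j + 2" for x
    using that letters(4) by (intro word_product_fixes) force
  have hi_fixes: "word_product hi x = x" if "x < i + j + 1" for x
    using that letters(1) by (intro word_product_fixes) force
  have lo_fixes: "word_product lo x = x" if "i + j \<le> x" for x
    using that letters(2) by (intro word_product_fixes) force
  note Q = word_product_rev_upt[of "i + 1" "j + 1"]
  \<comment> \<open>The products \<open>?f\<close>, \<open>?g\<close>, \<open>?h\<close> are the positions of the pipes below row \<open>i + 1\<close>, above it, and above row \<open>i\<close>.\<close>
  have g_eq: "?g x = word_product hi' (?Q (?f x))" for x
    by (simp only: row word_product_append_apply)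
  have g: "?g c = i + j" "?g b = i + j + 1" "?g i = i"
    unfolding g_eq Q using bc hi'_fixes gap(1) f_fixes[of i] by simp_all
  have g_a: "i + j + 2 \<le> ?g (i + 1)"
  proof -
    have "i + j + 2 \<le> word_product hi' (i + j + 2)" using letters(4) by (intro word_product_ge) auto
    then show ?thesis unfolding g_eq Q using f_fixes[of "i + 1"] by simp
  qed
  let ?rest = "lo @ row_word D (i + 1) @ C"
  \<comment> \<open>The letter of the crossing \<open>(i, j + 1)\<close> meets \<open>c\<close> and \<open>b\<close>; as the word is reduced, \<open>c < b\<close>.\<close>
  have reading: "reading_word D = (P @ hi) @ ((i + j) # ?rest)"
    using reading_word_D row_i by simp
  have rest: "word_product ?rest c = i + j" "word_product ?rest b = i + j + 1"
    using g lo_fixes by simp_all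
  have red: "reduced ((i + j) # ?rest)"
    and inv1: "inversions (word_product ((i + j) # ?rest)) \<subseteq> inversions w"
    using reduced_append[of "P @ hi" "(i + j) # ?rest", folded reading, OF rc_graph_D(4)]
    unfolding rc_graph_D(3) by blast+
  note cons = reduced_ConsE[OF red rest]
  have "c < b" by (rule cons)
  have "w b < w c" using cons(3) inv1 by (auto simp: inversions_def)
  have reading': "reading_word D = (P @ row_word D i) @ (row_word D (i + 1) @ C)"
    using reading_word_D by simp
  have "inversions ?g \<subseteq> inversions w"
    using reduced_append[of "P @ row_word D i" "row_word D (i + 1) @ C", folded reading', OF rc_graph_D(4)]
    unfolding rc_graph_D(3) by blast
  moreover have "(i + 1, c) \<in> inversions ?g" using c_gt g g_a by (simp add: inversions_def)
  ultimately have "w c < w (i + 1)" by (auto simp: inversions_def)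
  \<comment> \<open>None of the pipes up to \<open>i\<close> has passed \<open>b\<close> when it leaves row \<open>i\<close>: the pipe \<open>i\<close> turned up before
    the empty cell \<open>(i, j)\<close>, and the others have not entered yet.\<close>
  have h_b: "?h b = i + j" using g lo_fixes hi_fixes by (simp add: row_i simple_transposition_apply)
  have h_le: "?h x < ?h b" if "x \<in> {1..i}" for x
  proof (cases "x = i")
    case True
    have "word_product lo i \<le> i + j - 1"
      using letters(2) gap(1) by (intro word_product_le) force+
    then have lt: "word_product lo i < i + j" using gap(1) by simp
    then have "?h i = word_product lo i"
      using g(3) hi_fixes[of "word_product lo i"] by (simp add: row_i simple_transposition_apply)
    then show ?thesis using True h_b lt by metis
  next
    case False
    have "row_word D i @ row_word D (i + 1) @ C = rows_word D i M"
      using i_bounds rows_word_Cons[of i M D] rows_word_Cons[of "Suc i" M D] by (simp add: C_def)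
    then have "set (row_word D i @ row_word D (i + 1) @ C) \<subseteq> {i..}"
      using rows_word_ge[OF rc_graph_D(2,1), of i M] by metis
    then have "?h x = x"
      using that False by (intro word_product_fixes) force
    then show ?thesis using that h_b gap(1) by simp
  qed
  have w_h: "w x = word_product (concat (map (row_word D) [1..<i])) (?h x)" for x
    by (simp only: rc_graph_D(3)[symmetric] reading_word_D P_def rows_word_def word_product_append_apply)
  \<comment> \<open>Only \<open>i - 1\<close> rows remain, too few for all \<open>i\<close> pipes to pass \<open>b\<close>.\<close>
  have "card {x \<in> {1..i}. word_product (concat (map (row_word D) [1..<i])) (?h b)
        < word_product (concat (map (row_word D) [1..<i])) (?h x)}
      \<le> length (map (row_word D) [1..<i]) + card {x \<in> {1..i}. ?h b < ?h x}"
    using row_word_decreasing[OF rc_graph_D(1,2)]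
    by (intro overtaking_bound) (auto simp: bij_is_inj simp del: word_product_append_apply)
  also have "{x \<in> {1..i}. ?h b < ?h x} = {}" using h_le by fastforce
  finally have "card {x \<in> {1..i}. w b < w x} \<le> i - 1" by (simp only: w_h) simp
  then have "{x \<in> {1..i}. w b < w x} \<noteq> {1..i}" using i_bounds by force
  then obtain x where x: "1 \<le> x" "x \<le> i" "w x \<le> w b" by fastforce
  moreover have "w x \<noteq> w b" unfolding rc_graph_D(3)[symmetric] using x b_gt by simp
  ultimately have "w x < w b" by simp
  with x c_gt \<open>c < b\<close> \<open>w b < w c\<close> \<open>w c < w (i + 1)\<close> show ?thesis
    unfolding avoids_1432_def not_not
    by (intro exI[of _ x] exI[of _ "i + 1"] exI[of _ c] exI[of _ b]) simp
qed

end

lemma avoids_1432_inverse_move: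
  assumes w: "w \<in> S_infinity" and D: "D \<in> rc_graphs w" and av: "avoids_1432 w" and nlj: "\<not> left_justified D"
  obtains D' where "simple_ladder_move w D' D" "D' \<in> rc_graphs w" "(\<Sum>(i, j)\<in>D'. j) < (\<Sum>(i, j)\<in>D. j)"
proof -
  have fin: "finite D" using D by (simp add: rc_graphs_def)
  define gap where "gap = (\<lambda>i j. 1 \<le> j \<and> (i, j + 1) \<in> D \<and> (i, j) \<notin> D)"
  define j where "j = (LEAST j. \<exists>i. gap i j)"
  have "\<exists>j i. gap i j" using nlj by (auto simp: left_justified_def gap_def)
  then have "\<exists>i. gap i j" unfolding j_def by (rule LeastI_ex)
  have least: "\<not> gap i' j'" if "j' < j" for i' j' using not_less_Least that unfolding j_def by blast
  define i where "i = Max {i. gap i j}"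
  have fin_gap: "finite {i. gap i j}"
  proof (rule finite_subset)
    show "{i. gap i j} \<subseteq> fst ` D" by (force simp: gap_def)
  qed (use fin in simp)
  have ij: "gap i j" using Max_in[OF fin_gap] \<open>\<exists>i. gap i j\<close> by (auto simp: i_def)
  have greatest: "\<not> gap i' j" if "i < i'" for i'
    using Max_ge[OF fin_gap, of i'] that by (auto simp: i_def)
  obtain M where M: "\<And>i j. (i, j) \<in> D \<Longrightarrow> i < M \<and> j < M"
    using finite_nat_relation_bounded[OF fin] by blast
  interpret rc_graph_gap w D i j "M + 1"
  proof
    show "i' + 1 < M + 1 \<and> j' < M + 1" if "(i', j') \<in> D" for i' j' using M[OF that] by simp
    show "(i', j') \<in> D" if "1 \<le> j'" "j' < j" "(i', j' + 1) \<in> D" for i' j'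
      using least[OF that(2), of i'] that by (simp add: gap_def)
    show "(i', j) \<in> D" if "i < i'" "(i', j + 1) \<in> D" for i'
      using greatest[OF that(1)] that ij by (simp add: gap_def)
  qed (use w D ij in \<open>simp_all add: gap_def\<close>)
  have "(i + 1, j + 1) \<notin> D"
    using double_cross_1432 av low[of "i + 1"] by auto
  with not_cross_elbow have "(i + 1, j) \<notin> D" by blast
  from that[OF inverse_simple_ladder_move[OF \<open>(i + 1, j + 1) \<notin> D\<close> this]] show thesis .
qed

lemma avoids_1432_connected_to_left_justified:
  assumes w: "w \<in> S_infinity" and D: "D \<in> rc_graphs w" and av: "avoids_1432 w"
  shows "\<exists>E\<in>rc_graphs w. left_justified E \<and> connected_by_simple_ladder_moves w E D"
  using D
proof (induction "\<Sum>(i, j)\<in>D. j" arbitrary: D rule: less_induct)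
  case less
  show ?case
  proof (cases "left_justified D")
    case True
    then show ?thesis using less.prems by (auto simp: connected_by_simple_ladder_moves_def)
  next
    case False
    then obtain D' where D': "simple_ladder_move w D' D" "D' \<in> rc_graphs w" "(\<Sum>(i, j)\<in>D'. j) < (\<Sum>(i, j)\<in>D. j)"
      using avoids_1432_inverse_move[OF w less.prems av] by blast
    from less.hyps[OF D'(3,2)] obtain E where "E \<in> rc_graphs w" "left_justified E"
      "connected_by_simple_ladder_moves w E D'" by blast
    moreover have "connected_by_simple_ladder_moves w D' D"
      using D'(1) by (auto simp: connected_by_simple_ladder_moves_def)
    ultimately show ?thesis
      unfolding connected_by_simple_ladder_moves_def by (meson equivclp_trans)
  qed
qed

lemma avoids_1432_connected:
  assumes w: "w \<in> S_infinity" and av: "avoids_1432 w" and D: "D \<in> rc_graphs w" "D' \<in> rc_graphs w"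
  shows "connected_by_simple_ladder_moves w D D'"
proof -
  obtain E E' where E: "E \<in> rc_graphs w" "left_justified E" "connected_by_simple_ladder_moves w E D"
    and E': "E' \<in> rc_graphs w" "left_justified E'" "connected_by_simple_ladder_moves w E' D'"
    using avoids_1432_connected_to_left_justified[OF w _ av] D by meson
  have "E = E'" using left_justified_rc_graph_unique E E' by blast
  with E E' show ?thesis
    unfolding connected_by_simple_ladder_moves_def by (meson equivclp_sym equivclp_trans)
qed

section \<open>An invariant of simple ladder moves\<close>

definition weight :: "(nat \<times> nat) set \<Rightarrow> nat" where
  "weight D = (\<Sum>(i, j)\<in>D. i + j)"

lemma weight_insert: "finite D \<Longrightarrow> (i, j) \<notin> D \<Longrightarrow> weight (insert (i, j) D) = i + j + weight D"
  by (simp add: weight_def)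

lemma simple_ladder_move_weight:
  assumes "simple_ladder_move w D D'"
  shows "weight D = weight D'"
proof -
  obtain i j where ij: "finite D" "(i, j) \<in> D" "2 \<le> i" "(i - 1, j + 1) \<notin> D"
    "D' = (D - {(i, j)}) \<union> {(i - 1, j + 1)}"
    using assms by (auto simp: simple_ladder_move_def rc_graphs_def)
  have "weight (insert (i, j) (D - {(i, j)})) = i + j + weight (D - {(i, j)})"
    using ij by (intro weight_insert) auto
  moreover have "weight (insert (i - 1, j + 1) (D - {(i, j)})) = i - 1 + (j + 1) + weight (D - {(i, j)})"
    using ij by (intro weight_insert) auto
  moreover have "insert (i, j) (D - {(i, j)}) = D" "insert (i - 1, j + 1) (D - {(i, j)}) = D'"
    using ij by auto
  ultimately show ?thesis using ij(3) by simp
qed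

lemma connected_weight:
  assumes "connected_by_simple_ladder_moves w D D'"
  shows "weight D = weight D'"
  using assms unfolding connected_by_simple_ladder_moves_def
  by (induction rule: equivclp_induct) (auto dest: simple_ladder_move_weight)

section \<open>Reading words column by column, and top-justified graphs\<close>

definition column_word :: "(nat \<times> nat) set \<Rightarrow> nat \<Rightarrow> nat \<Rightarrow> nat list" where
  "column_word D n j = map (\<lambda>i. i + j - 1) (filter (\<lambda>i. (i, j) \<in> D) [1..<n])"

text \<open>The crossing of row \<open>i\<close> in the last column has a letter that exceeds all letters of earlier rows and
columns by at least two, so it can be pulled in front of them.\<close>

lemma pull_out_last_column:
  assumes "1 \<le> M" "1 \<le> n"
  shows "word_product (concat (map (\<lambda>i. row_segment D i 1 (Suc M)) [1..<n])) =
    word_product (column_word D n M @ concat (map (\<lambda>i. row_segment D i 1 M) [1..<n]))"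
  using assms(2)
proof (induction n rule: nat_induct_at_least)
  case base
  then show ?case by (simp add: column_word_def)
next
  case (Suc n)
  let ?P = "\<lambda>M. concat (map (\<lambda>i. row_segment D i 1 M) [1..<n])"
  let ?k = "if (n, M) \<in> D then [n + M - 1] else []"
  have letters: "l + 1 < n + M - 1" if l: "l \<in> set (?P M)" for l
  proof -
    obtain i where i: "1 \<le> i" "i < n" "l \<in> set (row_segment D i 1 M)" using l by auto
    then obtain j where "j < M" "l = i + j - 1" "1 \<le> j" by (auto simp: set_row_segment)
    then show ?thesis using i by linarith
  qed
  have split: "[1..<Suc n] = [1..<n] @ [n]" using Suc.hyps by simp
  have "word_product (concat (map (\<lambda>i. row_segment D i 1 (Suc M)) [1..<Suc n])) x =
      word_product (column_word D n M @ ?P M @ ?k @ row_segment D n 1 M) x" for x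
    unfolding split using fun_cong[OF Suc.IH, of "word_product (row_segment D n 1 (Suc M)) x"]
      row_segment_Suc[OF assms(1), of D n]
    by simp
  also have "word_product (column_word D n M @ ?P M @ ?k @ row_segment D n 1 M) =
      word_product (column_word D n M @ ?k @ ?P M @ row_segment D n 1 M)"
    using word_product_move_letter[of "?P M" "n + M - 1" "column_word D n M" "row_segment D n 1 M"] letters
    by (cases "(n, M) \<in> D") auto
  also have "column_word D n M @ ?k @ ?P M @ row_segment D n 1 M =
      column_word D (Suc n) M @ concat (map (\<lambda>i. row_segment D i 1 M) [1..<Suc n])"
    using Suc.hyps by (simp add: column_word_def)
  finally show ?case by (rule ext)
qed

text \<open>If one of two crossings lies strictly above and strictly to the left of the other, their letters commute. In all
other cases one of them lies weakly north-east of the other, and both orders of reading take that one first.\<close>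

lemma rows_eq_columns:
  assumes "1 \<le> M" "1 \<le> n"
  shows "word_product (concat (map (\<lambda>i. row_segment D i 1 M) [1..<n])) =
    word_product (concat (map (column_word D n) (rev [1..<M])))"
  using assms(1)
proof (induction M rule: nat_induct_at_least)
  case base
  have 1: "concat (map (\<lambda>i. row_segment D i 1 1) [1..<n]) = []" by (simp add: row_segment_def)
  have 2: "concat (map (column_word D n) (rev [1..<1])) = []" by simp
  show ?case by (simp only: 1 2)
next
  case (Suc M)
  have "word_product (concat (map (\<lambda>i. row_segment D i 1 (Suc M)) [1..<n])) x =
      word_product (concat (map (column_word D n) (rev [1..<Suc M]))) x" for x
    unfolding pull_out_last_column[OF Suc.hyps assms(2)] using Suc by simp
  then show ?case by (rule ext)
qed

definition top_graph :: "(nat \<Rightarrow> nat) \<Rightarrow> nat \<Rightarrow> (nat \<times> nat) set" where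
  "top_graph d M = {(i, j). 1 \<le> j \<and> j < M \<and> 1 \<le> i \<and> i \<le> d j}"

lemma top_graph_eq_image: "top_graph d M = (\<lambda>(j, i). (i, j)) ` Sigma {1..<M} (\<lambda>j. {1..d j})"
  by (auto simp: top_graph_def)

lemma finite_top_graph [simp]: "finite (top_graph d M)"
  by (simp add: top_graph_eq_image)

lemma card_top_graph: "card (top_graph d M) = (\<Sum>j\<in>{1..<M}. d j)"
proof -
  have "card (top_graph d M) = card (Sigma {1..<M} (\<lambda>j. {1..d j}))"
    unfolding top_graph_eq_image by (intro card_image) (auto simp: inj_on_def)
  then show ?thesis by simp
qed

text \<open>Column by column, the word of the top-justified graph is the reversed code word of \<open>p\<close>, so the graph
represents the inverse of \<open>p\<close>. The argument \<open>p x\<close> expresses this without mentioning the inverse.\<close>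

lemma top_graph_word_product:
  assumes p: "p permutes {1..}" "\<And>x. M \<le> x \<Longrightarrow> p x = x" "1 \<le> M" and "1 \<le> n"
    and d: "\<And>j. code p j < n"
  shows "word_product (rows_word (top_graph (code p) M) 1 n) (p x) = x"
proof -
  let ?T = "top_graph (code p) M"
  have col: "column_word ?T n j = [j..<j + code p j]" if "j \<in> {1..<M}" for j
  proof -
    have "[1..<n] = [1..<Suc (code p j)] @ [Suc (code p j)..<n]"
      using d[of j] by (intro upt_split) auto
    then have "filter (\<lambda>i. (i, j) \<in> ?T) [1..<n] = [1..<Suc (code p j)]"
      using that by (simp add: top_graph_def filter_empty_conv filter_id_conv del: upt_Suc)
    moreover have "map (\<lambda>i. i + j - 1) [1..<Suc c] = [j..<j + c]" for c
      by (induction c) auto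
    ultimately show ?thesis by (simp add: column_word_def)
  qed
  have "rows_word ?T 1 n = concat (map (\<lambda>i. row_segment ?T i 1 M) [1..<n])"
    unfolding rows_word_def
    by (intro arg_cong[where f = concat] map_cong refl row_word_eq_row_segment) (auto simp: top_graph_def)
  then have "word_product (rows_word ?T 1 n) = word_product (concat (map (column_word ?T n) (rev [1..<M])))"
    using rows_eq_columns[OF \<open>1 \<le> M\<close> \<open>1 \<le> n\<close>] by simp
  also have "map (column_word ?T n) (rev [1..<M]) = map (\<lambda>j. [j..<j + code p j]) (rev [1..<M])"
    using col by (intro map_cong) auto
  also have "concat \<dots> = rev (code_word (code p) 1 M)"
    by (simp add: code_word_def rev_concat rev_map comp_def)
  finally have *: "word_product (rows_word ?T 1 n) = word_product (rev (code_word (code p) 1 M))" .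
  have "word_product (code_word (code p) 1 M) x = p x" using code_word_product[OF p] by metis
  then show ?thesis unfolding * by (metis word_product_rev_apply)
qed

text \<open>Every row \<open>i < m\<close> of a left-justified graph preserves the order of the values above \<open>i\<close>.\<close>

lemma code_word_prefix_mono:
  assumes "k \<le> m" "m \<le> x" "x < y"
  shows "word_product (code_word c k m) x < word_product (code_word c k m) y"
  using assms
proof (induction "m - k" arbitrary: k)
  case 0
  then show ?case by (simp add: code_word_def)
next
  case (Suc l)
  let ?F = "word_product (code_word c (Suc k) m)"
  have "Suc k \<le> ?F x" "Suc k \<le> ?F y"
    using Suc code_word_ge[of c "Suc k" m] by (auto intro!: word_product_ge)
  moreover have "?F x < ?F y" using Suc by (intro Suc.hyps(1)) auto
  ultimately show ?case
    using Suc.hyps(2) by (simp add: code_word_Cons word_product_rev_upt) linarith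
qed

lemma word_product_eventually_fixes: "\<exists>N. \<forall>x\<ge>N. word_product as x = x"
proof -
  obtain N where N: "\<forall>k\<in>set as. k < N" using finite_nat_set_iff_bounded[of "set as"] by auto
  have "word_product as x = x" if "N + 1 \<le> x" for x using N that by (intro word_product_fixes) force
  then show ?thesis by blast
qed

lemma code_eq_inversions: "code p x = card {y. (x, y) \<in> inversions p}"
  by (simp add: code_def inversions_def)

section \<open>Two RC-graphs of different weight\<close>

text \<open>Choose a pattern whose middle entries are as close as possible, and then raise \<open>w a4\<close> as far as
possible below \<open>w a3\<close>. A value between the middle entries that exceeds \<open>w a4\<close> could replace \<open>a2\<close> or \<open>a3\<close> and would give
a closer pair.\<close>

lemma obtain_tight_1432:
  assumes inj: "inj w" and "\<not> avoids_1432 w"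
  obtains a1 a2 a3 a4 where "0 < a1" "a1 < a2" "a2 < a3" "a3 < a4" "w a1 < w a4" "w a4 < w a3" "w a3 < w a2"
    "\<And>r. a2 < r \<Longrightarrow> r < a3 \<Longrightarrow> w r < w a4"
    "\<And>y. a3 < y \<Longrightarrow> w a4 < w y \<Longrightarrow> w a3 \<le> w y"
proof -
  define pat where "pat = (\<lambda>a1 a2 a3 a4. 0 < a1 \<and> a1 < a2 \<and> a2 < a3 \<and> a3 < a4 \<and>
    w a1 < w a4 \<and> w a4 < w a3 \<and> w a3 < w a2)"
  define l where "l = (LEAST l. \<exists>a1 a2 a3 a4. pat a1 a2 a3 a4 \<and> a3 - a2 = l)"
  have "\<exists>a1 a2 a3 a4. pat a1 a2 a3 a4"
    using assms(2) unfolding avoids_1432_def pat_def by blast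
  then have "\<exists>l a1 a2 a3 a4. pat a1 a2 a3 a4 \<and> a3 - a2 = l" by blast
  then have "\<exists>a1 a2 a3 a4. pat a1 a2 a3 a4 \<and> a3 - a2 = l" unfolding l_def by (rule LeastI_ex)
  then obtain a1 a2 a3 a4 where a: "pat a1 a2 a3 a4" "a3 - a2 = l" by blast
  have least: "l \<le> a3 - a2" if "pat a1 a2 a3 a4" for a1 a2 a3 a4
    unfolding l_def using that by (intro Least_le) blast
  let ?S = "{y. a3 < y \<and> w y < w a3}"
  have "finite (w ` ?S)" using finite_smaller_values[OF inj] by (intro finite_imageI)
  moreover have "a4 \<in> ?S" using a by (simp add: pat_def)
  ultimately have "Max (w ` ?S) \<in> w ` ?S" "w a4 \<le> Max (w ` ?S)"
    and max: "\<And>y. y \<in> ?S \<Longrightarrow> w y \<le> Max (w ` ?S)" by (auto intro!: Max_in)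
  then obtain b where b: "b \<in> ?S" "w b = Max (w ` ?S)" "w a4 \<le> w b" by auto
  have pat_b: "pat a1 a2 a3 b" using a b by (auto simp: pat_def)
  show thesis
  proof (rule that[of a1 a2 a3 b])
    show "w r < w b" if "a2 < r" "r < a3" for r
    proof (rule ccontr)
      assume "\<not> w r < w b"
      moreover have "r \<noteq> b" "r \<noteq> a3" using that b by auto
      then have "w r \<noteq> w b" "w r \<noteq> w a3" using inj by (auto simp: inj_eq)
      ultimately have "pat a1 r a3 b \<or> pat a1 a2 r b"
        using pat_b that by (auto simp: pat_def)
      then show False using least[of a1 r a3 b] least[of a1 a2 r b] a(2) that by auto
    qed
    show "w a3 \<le> w y" if "a3 < y" "w b < w y" for y
      using max[of y] that b(2) by force
  qed (use pat_b in \<open>auto simp: pat_def\<close>)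
qed

text \<open>The second entry of the pattern is called \<open>n\<close>, because its row splits the graphs: above it lie the
\<open>n - 1\<close> rows of the factor \<open>u\<close>, below it the rows of \<open>v\<close>.\<close>

locale tight_1432 =
  fixes w :: "nat \<Rightarrow> nat" and a1 n a3 a4 N :: nat
  assumes w: "w permutes {1..}" "\<And>x. N \<le> x \<Longrightarrow> w x = x" and N: "1 \<le> N"
    and pos: "0 < a1" "a1 < n" "n < a3" "a3 < a4"
    and val: "w a1 < w a4" "w a4 < w a3" "w a3 < w n"
    and between: "\<And>r. n < r \<Longrightarrow> r < a3 \<Longrightarrow> w r < w a4"
    and tight: "\<And>y. a3 < y \<Longrightarrow> w a4 < w y \<Longrightarrow> w a3 \<le> w y"
begin

lemma w_mem: "w \<in> S_infinity"
proof -
  have "x < N" if "w x \<noteq> x" for x using w(2)[of x] that by (cases "x < N") auto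
  then have "{x. w x \<noteq> x} \<subseteq> {..<N}" by blast
  then have "finite {x. w x \<noteq> x}" by (rule finite_subset) simp
  then show ?thesis using w(1) by (simp add: S_infinity_def)
qed

lemma n_less_N: "n < N"
proof (rule ccontr)
  assume "\<not> n < N"
  then have "w n = n" "w a3 = a3" using w(2) pos by auto
  then show False using pos val by simp
qed

text \<open>The factors of \<open>w\<close> that come from its left-justified graph: the rows above row \<open>n\<close>, row \<open>n\<close> itself, and
the rows below.\<close>

definition "A_word = code_word (code w) 1 n"
definition "C_word = code_word (code w) (n + 1) N"
definition "u = word_product A_word"
definition "R = word_product (rev [n..<n + code w n])"
definition "v = word_product C_word"

lemma w_word: "code_word (code w) 1 N = A_word @ rev [n..<n + code w n] @ C_word"
  using code_word_split[of 1 n N "code w"] code_word_Cons[of n N "code w"] pos n_less_N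
  by (simp add: A_word_def C_word_def)

lemma w_eq: "w x = u (R (v x))"
  using fun_cong[OF code_word_product[OF w N, unfolded w_word], of x] by (simp add: u_def R_def v_def)

lemma card_inversions_w: "card (inversions w) = length A_word + code w n + length C_word"
proof -
  have "card (inversions w) = length (code_word (code w) 1 N)"
    using reduced_code_word[OF w N] code_word_product[OF w N] by (metis reduced_def)
  also have "\<dots> = length A_word + code w n + length C_word" unfolding w_word by simp
  finally show ?thesis .
qed

lemma inj: "inj w" using w(1) by (rule permutes_inj)

lemma u_mono: "n \<le> x \<Longrightarrow> x < y \<Longrightarrow> u x < u y"
  using code_word_prefix_mono[of 1 n x y] pos by (simp add: u_def A_word_def)

lemma u_mono_iff: "n \<le> x \<Longrightarrow> n \<le> y \<Longrightarrow> u x < u y \<longleftrightarrow> x < y"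
  using u_mono[of x y] u_mono[of y x] by (metis less_asym nat_neq_iff)

lemma u_inj [simp]: "u x = u y \<longleftrightarrow> x = y" by (simp add: u_def)
lemma v_inj [simp]: "v x = v y \<longleftrightarrow> x = y" by (simp add: v_def)
lemma R_inj [simp]: "R x = R y \<longleftrightarrow> x = y" by (simp add: R_def)

lemma v_permutes: "v permutes {n + 1..}"
  unfolding v_def C_word_def by (intro word_product_permutes code_word_ge)

lemma v_fixes: "x \<le> n \<Longrightarrow> v x = x"
  using permutes_not_in[OF v_permutes, of x] by simp

lemma v_ge: "n < v x \<longleftrightarrow> n < x"
  using permutes_in_image[OF v_permutes, of x] by (simp add: Suc_le_eq)

lemma R_apply: "R x = (if x = n then n + code w n else if n < x \<and> x \<le> n + code w n then x - 1 else x)"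
  by (simp add: R_def word_product_rev_upt)

lemma R_ge: "n \<le> x \<Longrightarrow> n \<le> R x" by (auto simp: R_apply)

lemma v_order:
  assumes "n < x" "n < y"
  shows "w x < w y \<longleftrightarrow> v x < v y"
proof -
  have "n < v x" "n < v y" using assms v_ge by auto
  then have "R (v x) < R (v y) \<longleftrightarrow> v x < v y" by (auto simp: R_apply)
  moreover have "n \<le> R (v x)" "n \<le> R (v y)" using R_ge \<open>n < v x\<close> \<open>n < v y\<close> by auto
  ultimately show ?thesis using u_mono_iff w_eq[of x] w_eq[of y] by simp
qed

text \<open>Below row \<open>n\<close> the pipe \<open>a4\<close> stands at \<open>K\<close>; row \<open>n\<close> moves it to \<open>k\<close>.\<close>

definition "K = v a4"
definition "k = K - 1"

lemma n_less_K: "n < K" using v_ge[of a4] pos by (simp add: K_def)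

lemma K_eq: "K = k + 1" using n_less_K by (simp add: k_def)

text \<open>Below row \<open>n\<close> the order of the pipes is that of their final values. No pipe beyond \<open>n\<close> has its value
strictly between \<open>w a4\<close> and \<open>w a3\<close>: those before \<open>a3\<close> end below \<open>w a4\<close>, those after \<open>a3\<close> are excluded by the choice of \<open>a4\<close>.\<close>

lemma v_a3: "v a3 = K + 1"
proof (rule ccontr)
  assume "v a3 \<noteq> K + 1"
  moreover have "K < v a3" using v_order[of a4 a3] pos val by (simp add: K_def)
  ultimately have lt: "K + 1 < v a3" by simp
  obtain z where z: "v z = K + 1" using permutes_surj[OF v_permutes] by (metis surjD)
  then have "n < z" using v_ge[of z] n_less_K by simp
  have "w a4 < w z" "w z < w a3"
    using v_order[of a4 z] v_order[of z a3] z lt \<open>n < z\<close> pos by (simp_all add: K_def)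
  then have "\<not> z < a3" "\<not> a3 < z" "z \<noteq> a3" using between[of z] tight[of z] \<open>n < z\<close> by auto
  then show False by simp
qed

text \<open>Since \<open>w a3 < w n\<close>, row \<open>n\<close> is long enough to cross both \<open>a3\<close> and \<open>a4\<close>.\<close>

lemma K_bound: "K + 1 \<le> n + code w n"
proof (rule ccontr)
  assume *: "\<not> K + 1 \<le> n + code w n"
  then have "R (K + 1) = K + 1" "R n = n + code w n" using n_less_K by (simp_all add: R_apply)
  moreover have "w a3 = u (R (K + 1))" "w n = u (R n)" by (simp_all add: w_eq[of a3] w_eq[of n] v_a3 v_fixes)
  ultimately show False using * val(3) u_mono[of "n + code w n" "K + 1"] by simp
qed

lemma R_K: "R K = k" "R (K + 1) = K"
  using K_bound n_less_K by (simp_all add: R_apply k_def)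

text \<open>A crossing of \<open>a3\<close> and \<open>a4\<close> below row \<open>n\<close> has the same effect as one above it, on the next lower diagonal.\<close>

lemma R_conjugate: "simple_transposition k (R (simple_transposition K x)) = R x"
proof -
  have "R x = k \<longleftrightarrow> x = K" "R x = k + 1 \<longleftrightarrow> x = K + 1"
    using R_K K_eq by (metis R_inj)+
  then show ?thesis
    using R_K K_eq by (auto simp: simple_transposition_apply)
qed

text \<open>The pipes below row \<open>n\<close> with the crossing of \<open>a3\<close> and \<open>a4\<close> undone.\<close>

definition "v' = word_product (K # C_word)"

lemma v'_apply: "v' x = simple_transposition K (v x)" by (simp add: v'_def v_def)

lemma v'_permutes: "v' permutes {n + 1..}"
  unfolding v'_def C_word_def using n_less_K code_word_ge[of "code w" "n + 1" N]
  by (intro word_product_permutes) auto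

lemma card_inversions_v': "card (inversions v') + 1 \<le> length C_word"
proof -
  have "inversions v = insert (a3, a4) (inversions (simple_transposition K \<circ> v))"
    "(a3, a4) \<notin> inversions (simple_transposition K \<circ> v)"
    using inversions_simple_transposition_down[of v a4 K a3] pos v_a3
    by (simp_all add: K_def inj_def)
  moreover have "simple_transposition K \<circ> v = v'" by (auto simp: v'_apply)
  ultimately have "inversions v = insert (a3, a4) (inversions v')" "(a3, a4) \<notin> inversions v'" by simp_all
  then have "card (inversions v) = card (inversions v') + 1" by (simp add: v'_def)
  then show ?thesis using card_inversions_le[of C_word] by (simp add: v_def)
qed

text \<open>The pipe \<open>n + 1\<close> is \<open>a3\<close> itself or ends below \<open>w a4\<close>, so after \<open>v'\<close> it stands at most at \<open>K\<close>. Hence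
a crossing with letter \<open>K\<close> in row \<open>n + 1\<close> lies to the right of all others of that row and is read before them.\<close>

lemma code_v'_first: "code v' (n + 1) < K - n"
proof -
  have "v' (n + 1) \<le> K"
  proof (cases "n + 1 = a3")
    case True
    then show ?thesis using v_a3 by (simp add: v'_apply simple_transposition_apply)
  next
    case False
    then have "v (n + 1) < K"
      using between[of "n + 1"] v_order[of "n + 1" a4] pos by (simp add: K_def)
    then show ?thesis by (simp add: v'_apply simple_transposition_apply)
  qed
  then show ?thesis using code_first[OF v'_permutes] by simp
qed

text \<open>The inverse of \<open>u\<close>, and the inverse of \<open>u\<close> with the crossing of \<open>a3\<close> and \<open>a4\<close> added at its end.\<close>

definition "p = word_product (rev A_word)"
definition "p' = word_product (k # rev A_word)"

lemma p_u [simp]: "p (u x) = x" by (simp add: p_def u_def)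
lemma u_p [simp]: "u (p x) = x"
  using word_product_rev_apply[of "rev A_word" x] by (simp add: p_def u_def)
lemma p_inj [simp]: "p x = p y \<longleftrightarrow> x = y" by (simp add: p_def)

lemma p'_apply: "p' x = simple_transposition k (p x)" by (simp add: p_def p'_def)

lemma k_ge: "n \<le> k" using n_less_K by (simp add: k_def)

lemma p_permutes: "p permutes {1..}"
  unfolding p_def A_word_def using code_word_ge[of "code w" 1 n] by (intro word_product_permutes) auto

lemma p'_permutes: "p' permutes {1..}"
  unfolding p'_def A_word_def using code_word_ge[of "code w" 1 n] k_ge pos
  by (intro word_product_permutes) auto

lemma u_k: "u k = w a4" "u (k + 1) = w a3"
  using R_K K_eq by (simp_all add: w_eq[of a3] w_eq[of a4] v_a3 K_def[symmetric])

lemma p_val: "p (w a4) = k" "p (w a3) = k + 1"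
  using p_u[of k] p_u[of "k + 1"] by (simp_all only: u_k)

text \<open>As \<open>u\<close> preserves the order from \<open>n\<close> on, only the \<open>n - 1\<close> smaller pipes can contribute to a code entry. At the
value \<open>w a4\<close>, the pipe \<open>a1\<close> does not contribute either, since \<open>w a1 < w a4\<close>; this leaves room for one more crossing.\<close>

lemma code_p_bounds: "code p j \<le> n - 1" "code p (w a4) + 1 \<le> n - 1"
proof -
  have sub: "p ` {y. j < y \<and> p y < p j} \<subseteq> {1..<n}" for j
  proof
    fix z assume "z \<in> p ` {y. j < y \<and> p y < p j}"
    then obtain y where y: "z = p y" "j < y" "p y < p j" by auto
    have "1 \<le> p y" using y permutes_in_image[OF p_permutes, of y] by simp
    moreover have "p y < n" using u_mono[of "p y" "p j"] y by force
    ultimately show "z \<in> {1..<n}" using y by simp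
  qed
  have card: "code p j = card (p ` {y. j < y \<and> p y < p j})" for j
    unfolding code_def by (intro card_image[symmetric]) (auto simp: inj_on_def)
  show "code p j \<le> n - 1" using card_mono[OF _ sub, of j] card[of j] by simp
  have "a1 \<notin> p ` {y. w a4 < y \<and> p y < p (w a4)}"
  proof
    assume "a1 \<in> p ` {y. w a4 < y \<and> p y < p (w a4)}"
    then obtain y where "a1 = p y" "w a4 < y" by auto
    then have "y = u a1" by simp
    also have "\<dots> = w a1" using pos by (simp add: w_eq[of a1] v_fixes R_apply)
    finally show False using \<open>w a4 < y\<close> val by simp
  qed
  then have "p ` {y. w a4 < y \<and> p y < p (w a4)} \<subseteq> {1..<n} - {a1}" using sub[of "w a4"] by blast
  then have "code p (w a4) \<le> card ({1..<n} - {a1})" unfolding card by (intro card_mono) auto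
  then show "code p (w a4) + 1 \<le> n - 1" using pos by simp
qed

text \<open>Count the \<open>k\<close> values that \<open>p\<close> sends below \<open>k\<close>: all values below \<open>w a4\<close> are among them, because \<open>u\<close>
preserves the order from \<open>k\<close> on, and the others make up the code entry. So the crossing added to the column
of \<open>w a4\<close> in row \<open>code p (w a4) + 1\<close> has the letter \<open>k\<close>.\<close>

lemma code_p_val: "w a4 + code p (w a4) = k"
proof -
  have *: "p y < k" if "y < w a4" for y
  proof (rule ccontr)
    assume "\<not> p y < k"
    moreover have "p y \<noteq> k" using that p_val(1) p_inj[of y "w a4"] by auto
    ultimately have "u k < u (p y)" using k_ge by (intro u_mono) auto
    then show False using that by (simp add: u_k)
  qed
  have "u ` {..<k} = {y. p y < k}"
  proof (intro equalityI subsetI)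
    fix y assume "y \<in> {y. p y < k}"
    then show "y \<in> u ` {..<k}" using u_p[of y] by (metis imageI lessThan_iff mem_Collect_eq)
  qed auto
  also have "\<dots> = {..<w a4} \<union> {y. w a4 < y \<and> p y < p (w a4)}"
    using * p_val(1) by (auto simp: not_less) (metis le_neq_implies_less less_irrefl)
  finally have "card (u ` {..<k}) = card \<dots>" by simp
  moreover have "card (u ` {..<k}) = k" by (subst card_image) (auto simp: inj_on_def)
  moreover have "card ({..<w a4} \<union> {y. w a4 < y \<and> p y < p (w a4)}) = w a4 + code p (w a4)"
    unfolding code_def using finite_smaller_values[OF permutes_inj[OF p_permutes]]
    by (subst card_Un_disjoint) auto
  ultimately show ?thesis by simp
qed

lemma code_p': "code p' j = (if j = w a4 then code p j + 1 else code p j)"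
proof -
  have "inj p" by (simp add: inj_def)
  note up = inversions_simple_transposition_up[OF this p_val val(2)]
  have "simple_transposition k \<circ> p = p'" by (auto simp: p'_apply)
  with up have inv: "inversions p' = insert (w a4, w a3) (inversions p)" by simp
  have "finite {y. (w a4, y) \<in> inversions p}"
    using finite_smaller_values[OF \<open>inj p\<close>, of "w a4"] by (simp add: inversions_def)
  moreover have "{y. (w a4, y) \<in> inversions p'} = insert (w a3) {y. (w a4, y) \<in> inversions p}"
    using inv by auto
  moreover have "{y. (j, y) \<in> inversions p'} = {y. (j, y) \<in> inversions p}" if "j \<noteq> w a4"
    using inv that by auto
  ultimately show ?thesis using up(2) by (simp add: code_eq_inversions)
qed

text \<open>Counting crossings from above is enough: a word with product \<open>w\<close> has at least as many letters as \<open>w\<close> has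
inversions.\<close>

lemma stacked_rc_graph:
  assumes T: "finite T" "T \<subseteq> {1..<n} \<times> {1..}" and Y: "finite Y" "Y \<subseteq> {n + 1..<L} \<times> {1..}" and "n < L"
    and prod: "\<And>x. word_product (rows_word T 1 n) (R (word_product (rows_word Y (n + 1) L) x)) = w x"
    and card: "card T + card Y \<le> length A_word + length C_word"
  shows "T \<union> {n} \<times> {1..code w n} \<union> Y \<in> rc_graphs w"
proof -
  let ?D = "T \<union> {n} \<times> {1..code w n} \<union> Y"
  have D: "finite ?D" "?D \<subseteq> {1..} \<times> {1..}" using T Y pos by auto
  have "row_word ?D n = row_segment ?D n 1 (Suc (code w n))"
    using T Y by (intro row_word_eq_row_segment) auto
  also have "\<dots> = rev [n..<n + code w n]" by (intro row_segment_full) auto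
  finally have row: "row_word ?D n = rev [n..<n + code w n]" .
  have "fst ` ?D \<subseteq> {1..<L}" using T Y pos \<open>n < L\<close> by auto
  then have "reading_word ?D = rows_word ?D 1 L" by (rule reading_word_eq_rows_word)
  also have "\<dots> = rows_word ?D 1 n @ rows_word ?D n L"
    using pos \<open>n < L\<close> by (intro rows_word_split) auto
  also have "rows_word ?D 1 n = rows_word T 1 n" using Y by (intro rows_word_cong) auto
  also have "rows_word ?D n L = rev [n..<n + code w n] @ rows_word ?D (n + 1) L"
    using rows_word_Cons[OF \<open>n < L\<close>, of ?D] row by simp
  also have "rows_word ?D (n + 1) L = rows_word Y (n + 1) L" using T by (intro rows_word_cong) auto
  finally have reading: "reading_word ?D =
    rows_word T 1 n @ rev [n..<n + code w n] @ rows_word Y (n + 1) L" .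
  have w_prod: "word_product (reading_word ?D) = w"
  proof
    show "word_product (reading_word ?D) x = w x" for x
      using prod[of x] unfolding reading by (simp add: R_def)
  qed
  have "card ?D \<le> card (T \<union> {n} \<times> {1..code w n}) + card Y" by (rule card_Un_le)
  also have "card (T \<union> {n} \<times> {1..code w n}) \<le> card T + card ({n} \<times> {1..code w n})" by (rule card_Un_le)
  finally have "card ?D \<le> card (inversions w)" using card card_inversions_w by simp
  moreover have "card (inversions w) \<le> card ?D"
    using card_inversions_le[of "reading_word ?D"] unfolding w_prod length_reading_word[OF D(1)] .
  ultimately have "reduced (reading_word ?D)"
    unfolding reduced_def w_prod length_reading_word[OF D(1)] by simp
  then show ?thesis using D w_prod by (simp add: mem_rc_graphs_iff[OF w_mem])
qed

lemma rows_word_left_justified: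
  assumes "\<And>i j. m \<le> i \<Longrightarrow> i < L \<Longrightarrow> (i, j) \<in> Y \<longleftrightarrow> 1 \<le> j \<and> j \<le> c i"
  shows "rows_word Y m L = code_word c m L"
  unfolding rows_word_def code_word_def
proof (intro arg_cong[where f = concat] map_cong refl)
  fix i assume i: "i \<in> set [m..<L]"
  then have "row_word Y i = row_segment Y i 1 (Suc (c i))"
    using assms by (intro row_word_eq_row_segment) auto
  also have "\<dots> = rev [i..<i + c i]" using assms i by (intro row_segment_full) auto
  finally show "row_word Y i = rev [i..<i + c i]" .
qed

text \<open>Both graphs extend a common graph \<open>?E\<close> by a single crossing of the pipes \<open>a3\<close> and \<open>a4\<close>: in one of them it is
\<open>?Z\<close> below row \<open>n\<close> with letter \<open>K\<close>, in the other one it is \<open>?X\<close> above row \<open>n\<close> with letter \<open>K - 1\<close>.\<close>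

lemma rc_graphs_of_different_weight: "\<exists>D\<in>rc_graphs w. \<exists>D'\<in>rc_graphs w. weight D \<noteq> weight D'"
proof -
  obtain L1 L2 L3 where L123: "\<forall>x\<ge>L1. v' x = x" "\<forall>x\<ge>L2. p x = x" "\<forall>x\<ge>L3. p' x = x"
    unfolding v'_def p_def p'_def using word_product_eventually_fixes by metis
  \<comment> \<open>Beyond \<open>L\<close> all permutations involved are the identity, and the column \<open>w a4\<close> lies before \<open>L\<close>.\<close>
  define L where "L = L1 + L2 + L3 + n + w a4 + 2"
  have L: "\<And>x. L \<le> x \<Longrightarrow> v' x = x" "\<And>x. L \<le> x \<Longrightarrow> p x = x" "\<And>x. L \<le> x \<Longrightarrow> p' x = x"
    using L123 by (simp_all add: L_def)
  have nL: "n < L" "n + 1 < L" "1 \<le> L" "w a4 < L" by (simp_all add: L_def)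
  let ?T = "top_graph (code p) L" and ?T' = "top_graph (code p') L"
  let ?X = "(code p (w a4) + 1, w a4)"
  have "1 \<le> w a4" using permutes_in_image[OF w(1), of a4] pos by simp
  have T_insert: "?T' = insert ?X ?T" "?X \<notin> ?T"
    using \<open>1 \<le> w a4\<close> nL by (auto simp: top_graph_def code_p' le_Suc_eq split: if_splits)
  have code_p'_bound: "code p' j \<le> n - 1" for j
    using code_p_bounds by (simp add: code_p')
  have "top_graph d L \<subseteq> {1..<n} \<times> {1..}" if "\<And>j. d j \<le> n - 1" for d
  proof
    fix x assume "x \<in> top_graph d L"
    then obtain i j where "x = (i, j)" "1 \<le> j" "1 \<le> i" "i \<le> d j" by (auto simp: top_graph_def)
    then show "x \<in> {1..<n} \<times> {1..}" using that[of j] pos by simp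
  qed
  then have T_rows: "?T \<subseteq> {1..<n} \<times> {1..}" "?T' \<subseteq> {1..<n} \<times> {1..}"
    using code_p_bounds(1) code_p'_bound by blast+
  have code_less: "code p j < n" "code p' j < n" for j
    using code_p_bounds(1)[of j] code_p'_bound[of j] pos by simp_all
  have prodT: "word_product (rows_word ?T 1 n) (p x) = x" for x
    using code_less(1) pos by (intro top_graph_word_product p_permutes L nL) auto
  have prodT': "word_product (rows_word ?T' 1 n) (p' x) = x" for x
    using code_less(2) pos by (intro top_graph_word_product p'_permutes L nL) auto
  have "card ?T = card (inversions p)"
    unfolding card_top_graph by (intro card_inversions_eq_sum_code[symmetric] p_permutes L)
  then have card_T: "card ?T \<le> length A_word" using card_inversions_le[of "rev A_word"] by (simp add: p_def)
  let ?B = "{(i, j). n + 1 \<le> i \<and> i < L \<and> 1 \<le> j \<and> j \<le> code v' i}"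
  let ?Z = "(n + 1, K - n)"
  have B_eq: "?B = Sigma {n + 1..<L} (\<lambda>i. {1..code v' i})" by auto
  have fin_B: "finite ?B" unfolding B_eq by simp
  have "card ?B = card (inversions v')"
    unfolding B_eq by (subst card_inversions_eq_sum_code[OF v'_permutes L(1)]) simp_all
  then have card_B: "card ?B + 1 \<le> length C_word" using card_inversions_v' by simp
  have wordB: "rows_word ?B (n + 1) L = code_word (code v') (n + 1) L"
    by (intro rows_word_left_justified) auto
  have prodB: "word_product (code_word (code v') (n + 1) L) = v'"
    using nL by (intro code_word_product v'_permutes L) auto
  have Z: "?Z \<notin> ?B" using code_v'_first by auto
  have rowZ: "row_word (insert ?Z ?B) (n + 1) = K # rev [n + 1..<n + 1 + code v' (n + 1)]"
  proof -
    let ?E = "insert ?Z ?B" and ?c = "code v' (n + 1)"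
    have "row_word ?E (n + 1) = row_segment ?E (n + 1) 1 (Suc (K - n))"
      using code_v'_first n_less_K by (intro row_word_eq_row_segment) auto
    also have "\<dots> = [n + 1 + (K - n) - 1] @ row_segment ?E (n + 1) 1 (K - n)"
      using n_less_K by (subst row_segment_Suc) auto
    also have "row_segment ?E (n + 1) 1 (K - n) =
        row_segment ?E (n + 1) (Suc ?c) (K - n) @ row_segment ?E (n + 1) 1 (Suc ?c)"
      using code_v'_first by (intro row_segment_split) auto
    also have "row_segment ?E (n + 1) (Suc ?c) (K - n) = []" by (intro row_segment_empty) auto
    also have "row_segment ?E (n + 1) 1 (Suc ?c) = rev [n + 1..<n + 1 + ?c]"
      using nL by (intro row_segment_full) auto
    finally show ?thesis using n_less_K by simp
  qed
  have "rows_word (insert ?Z ?B) (n + 1) L = K # code_word (code v') (n + 1) L"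
  proof -
    have "rows_word (insert ?Z ?B) (n + 2) L = rows_word ?B (n + 2) L" by (intro rows_word_cong) auto
    also have "\<dots> = code_word (code v') (n + 2) L" by (intro rows_word_left_justified) auto
    finally show ?thesis
      using rows_word_Cons[OF nL(2), of "insert ?Z ?B"] rowZ code_word_Cons[OF nL(2), of "code v'"] by simp
  qed
  then have prodZB: "word_product (rows_word (insert ?Z ?B) (n + 1) L) x = v x" for x
    using fun_cong[OF prodB, of x] by (simp add: v'_apply)
  let ?E = "?T \<union> {n} \<times> {1..code w n} \<union> ?B"
  \<comment> \<open>The crossing of \<open>a3\<close> and \<open>a4\<close> below row \<open>n\<close>, as the last crossing \<open>?Z\<close> of row \<open>n + 1\<close>.\<close>
  have D: "?T \<union> {n} \<times> {1..code w n} \<union> insert ?Z ?B \<in> rc_graphs w"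
  proof (rule stacked_rc_graph)
    show "word_product (rows_word ?T 1 n) (R (word_product (rows_word (insert ?Z ?B) (n + 1) L) x)) = w x" for x
      using prodT[of "u (R (v x))"] prodZB w_eq[of x] by simp
    show "card ?T + card (insert ?Z ?B) \<le> length A_word + length C_word"
      using card_T card_B Z fin_B by simp
  qed (use T_rows fin_B nL n_less_K in auto)
  \<comment> \<open>The same crossing above row \<open>n\<close>, at the foot \<open>?X\<close> of the column \<open>w a4\<close> of the top-justified graph.\<close>
  have D': "?T' \<union> {n} \<times> {1..code w n} \<union> ?B \<in> rc_graphs w"
  proof (rule stacked_rc_graph)
    fix x
    have "word_product (rows_word ?T' 1 n) y = u (simple_transposition k y)" for y
      using prodT'[of "u (simple_transposition k y)"] by (simp add: p'_apply)
    then have "word_product (rows_word ?T' 1 n) (R (v' x)) = w x"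
      using R_conjugate[of "v x"] w_eq[of x] by (simp add: v'_apply)
    then show "word_product (rows_word ?T' 1 n) (R (word_product (rows_word ?B (n + 1) L) x)) = w x"
      unfolding wordB prodB .
    show "card ?T' + card ?B \<le> length A_word + length C_word"
      using card_T card_B T_insert by simp
  qed (use T_rows fin_B nL in auto)
  have E: "finite ?E" "?X \<notin> ?E" "?Z \<notin> ?E"
    using fin_B Z T_insert(2) T_rows code_p_bounds(2) pos by auto
  have "?T \<union> {n} \<times> {1..code w n} \<union> insert ?Z ?B = insert ?Z ?E"
    "?T' \<union> {n} \<times> {1..code w n} \<union> ?B = insert ?X ?E"
    unfolding T_insert(1) by auto
  moreover have "weight (insert ?Z ?E) = n + 1 + (K - n) + weight ?E"
    using E by (intro weight_insert) auto
  moreover have "weight (insert ?X ?E) = code p (w a4) + 1 + w a4 + weight ?E"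
    using E by (intro weight_insert) auto
  ultimately have "weight (?T \<union> {n} \<times> {1..code w n} \<union> insert ?Z ?B)
      \<noteq> weight (?T' \<union> {n} \<times> {1..code w n} \<union> ?B)"
    using code_p_val K_eq k_ge by simp
  with D D' show ?thesis by blast
qed

end

lemma contains_1432_disconnected:
  assumes "w \<in> S_infinity" "\<not> avoids_1432 w"
  shows "\<exists>D\<in>rc_graphs w. \<exists>D'\<in>rc_graphs w. \<not> connected_by_simple_ladder_moves w D D'"
proof -
  obtain N where N: "w permutes {1..}" "1 \<le> N" "\<forall>x\<ge>N. w x = x" by (rule S_infinityE[OF assms(1)])
  obtain a1 a2 a3 a4 where a: "0 < a1" "a1 < a2" "a2 < a3" "a3 < a4" "w a1 < w a4" "w a4 < w a3" "w a3 < w a2"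
    "\<And>r. a2 < r \<Longrightarrow> r < a3 \<Longrightarrow> w r < w a4"
    "\<And>y. a3 < y \<Longrightarrow> w a4 < w y \<Longrightarrow> w a3 \<le> w y"
    by (rule obtain_tight_1432[OF permutes_inj[OF N(1)] assms(2)]) blast
  interpret tight_1432 w a1 a2 a3 a4 N
    by standard (use N a in auto)
  show ?thesis using rc_graphs_of_different_weight connected_weight by blast
qed

theorem theorem4p1:
  fixes w :: "nat \<Rightarrow> nat"
  assumes "w \<in> S_infinity"
  shows "(\<forall>D \<in> rc_graphs w. \<forall>D' \<in> rc_graphs w. connected_by_simple_ladder_moves w D D')
    \<longleftrightarrow> avoids_1432 w"
  using avoids_1432_connected[OF assms] contains_1432_disconnected[OF assms] by blast

end
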